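(* Let $\mathcal D$ be a complex, 2-dimensional foliation on a Kähler surface $(M,g,J)$ with Kähler form $\omega$, and let $\mathcal E=\mathcal D^\perp$. Let $I$ be the almost Hermitian structure with $I|_{\mathcal D}=J|_{\mathcal D}$, $I|_{\mathcal E}=-J|_{\mathcal E}$, let $\Omega_I$ be its Kähler form, and let $\theta$ be the 1-form determined by $d\Omega_I=2\theta\wedge\Omega_I$. The following conditions are equivalent: (a) $\mathcal D$ is conformal; (b) $\mathcal D$ is quasi holomorphic, i.e. $(L_\xi J)(\mathcal E)\subset\mathcal D$ for every $\xi\in\Gamma(\mathcal D)$; (c) $2g(\nabla_X\xi,Y)=\theta(\xi)\,g(X,Y)+(J\theta)(\xi)\,\omega(X,Y)$ for all $\xi\in\Gamma(\mathcal D)$ and $X,Y\in\mathcal E$.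
   Context: A Kähler surface is a connected Kähler manifold $(M,g,J)$ of real dimension $4$, with Levi-Civita connection $\nabla$ and Kähler form $\omega(X,Y)=g(JX,Y)$. A foliation is identified with the distribution $\mathcal D$ of vectors tangent to its leaves; dimension means real rank. $\mathcal D$ is complex if $J(\mathcal D)\subset\mathcal D$. $\Omega_I(X,Y)=g(IX,Y)$. For a 1-form $\theta$, $(J\theta)(\xi)=-\theta(J\xi)$. (The 1-form $\theta$ with $d\Omega_I=2\theta\wedge\Omega_I$ exists and is unique in dimension 4; writing $\omega=\omega_1+\omega_2$ with $\omega_1,\omega_2$ the parts of $\omega$ supported on $\mathcal D$ and $\mathcal E$, it is equivalently the 1-form vanishing on $\mathcal E$ with $d\omega_2=\theta\wedge\omega_2$.) The foliation $\mathcal D$ is called conformal if there is a 1-form $\alpha$ vanishing on $\mathcal D^\perp$ such that $L_Vg=\alpha(V)g$ holds on $\mathcal D^\perp$ (i.e. when evaluated on pairs of vectors in $\mathcal D^\perp$) for every vector field $V$ tangent to $\mathcal D$. $L$ denotes the Lie derivative. *)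

theory Defs
  imports "HOL-Analysis.Analysis" "HOL-Library.Function_Algebras"
begin

instantiation "fun" :: (type, real_vector) real_vector
begin

definition scaleR_fun_def: "scaleR r f = (\<lambda>x. r *\<^sub>R f x)"

instance
  by standard (simp_all add: scaleR_fun_def fun_eq_iff scaleR_add_right scaleR_add_left)

end

section \<open>Smooth maps between Euclidean spaces\<close>

text \<open>For open \<open>S\<close> in finite dimensions this is the usual notion of class \<open>C\<^sup>k\<close>: all iterated
  directional derivatives up to order \<open>k\<close> exist on \<open>S\<close>, with total differentiability at each stage.\<close>

primrec Ck_on :: "nat \<Rightarrow> 'a::euclidean_space set \<Rightarrow> ('a \<Rightarrow> 'b::euclidean_space) \<Rightarrow> bool" where
  "Ck_on 0 S f \<longleftrightarrow> continuous_on S f"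
| "Ck_on (Suc k) S f \<longleftrightarrow>
     (\<forall>x\<in>S. f differentiable (at x)) \<and> (\<forall>v. Ck_on k S (\<lambda>x. frechet_derivative f (at x) v))"

definition smooth_on :: "'a::euclidean_space set \<Rightarrow> ('a \<Rightarrow> 'b::euclidean_space) \<Rightarrow> bool" where
  "smooth_on S f \<longleftrightarrow> (\<forall>k. Ck_on k S f)"

section \<open>Smooth manifolds of dimension 4\<close>

text \<open>The manifold is the whole type \<open>'m\<close>. A chart is a pair of its domain and its coordinate map;
  the values of the coordinate map outside the domain are irrelevant.\<close>

type_synonym 'm chart = "'m set \<times> ('m \<Rightarrow> real^4)"

abbreviation chart_inv :: "'m chart \<Rightarrow> real^4 \<Rightarrow> 'm" where
  "chart_inv c \<equiv> inv_into (fst c) (snd c)"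

definition is_chart :: "'m::topological_space chart \<Rightarrow> bool" where
  "is_chart c \<longleftrightarrow> open (fst c) \<and> open (snd c ` fst c) \<and>
     homeomorphism (fst c) (snd c ` fst c) (snd c) (chart_inv c)"

definition compatible :: "'m chart \<Rightarrow> 'm chart \<Rightarrow> bool" where
  "compatible c d \<longleftrightarrow>
     smooth_on (snd c ` (fst c \<inter> fst d)) (snd d \<circ> chart_inv c) \<and>
     smooth_on (snd d ` (fst c \<inter> fst d)) (snd c \<circ> chart_inv d)"

definition is_atlas :: "'m::topological_space chart set \<Rightarrow> bool" where
  "is_atlas A \<longleftrightarrow> (\<forall>c\<in>A. is_chart c) \<and> (\<forall>c\<in>A. \<forall>d\<in>A. compatible c d) \<and> (\<Union>c\<in>A. fst c) = UNIV"

text \<open>The charts of the smooth structure (maximal atlas) generated by \<open>A\<close>.\<close>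

definition admissible :: "'m::topological_space chart set \<Rightarrow> 'm chart \<Rightarrow> bool" where
  "admissible A c \<longleftrightarrow> is_chart c \<and> (\<forall>d\<in>A. compatible c d)"

definition smooth_fun :: "'m::topological_space chart set \<Rightarrow> 'm set \<Rightarrow> ('m \<Rightarrow> real) \<Rightarrow> bool" where
  "smooth_fun A U f \<longleftrightarrow> (\<forall>c\<in>A. smooth_on (snd c ` (U \<inter> fst c)) (f \<circ> chart_inv c))"

definition smooth_near :: "'m::topological_space chart set \<Rightarrow> 'm \<Rightarrow> ('m \<Rightarrow> real) \<Rightarrow> bool" where
  "smooth_near A p f \<longleftrightarrow> (\<exists>U. open U \<and> p \<in> U \<and> smooth_fun A U f)"

section \<open>Tangent vectors and vector fields\<close>

text \<open>A tangent vector at \<open>p\<close> is a directional derivative operator on the functions that are smooth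
  near \<open>p\<close>; it is set to \<open>0\<close> on all other functions, so that equal operators are equal as HOL
  functions. The vector \<open>coord_vec A c p a\<close> is \<open>\<Sum>i. a\<^sub>i \<partial>/\<partial>x\<^sub>i\<close> at \<open>p\<close> for the coordinates of \<open>c\<close>.\<close>

type_synonym 'm tvec = "('m \<Rightarrow> real) \<Rightarrow> real"
type_synonym 'm vfield = "'m \<Rightarrow> 'm tvec"

definition coord_vec :: "'m::topological_space chart set \<Rightarrow> 'm chart \<Rightarrow> 'm \<Rightarrow> real^4 \<Rightarrow> 'm tvec" where
  "coord_vec A c p a = (\<lambda>f. if smooth_near A p f
     then frechet_derivative (f \<circ> chart_inv c) (at (snd c p)) a else 0)"

definition tangent_space :: "'m::topological_space chart set \<Rightarrow> 'm \<Rightarrow> 'm tvec set" where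
  "tangent_space A p = {coord_vec A c p a |c a. c \<in> A \<and> p \<in> fst c}"

definition smooth_vf :: "'m::topological_space chart set \<Rightarrow> 'm set \<Rightarrow> 'm vfield \<Rightarrow> bool" where
  "smooth_vf A U X \<longleftrightarrow> (\<forall>p\<in>U. X p \<in> tangent_space A p) \<and>
     (\<forall>V f. open V \<and> V \<subseteq> U \<and> smooth_fun A V f \<longrightarrow> smooth_fun A V (\<lambda>q. X q f))"

definition lie_bracket :: "'m::topological_space chart set \<Rightarrow> 'm vfield \<Rightarrow> 'm vfield \<Rightarrow> 'm vfield" where
  "lie_bracket A X Y = (\<lambda>p f. if smooth_near A p f
     then X p (\<lambda>q. Y q f) - Y p (\<lambda>q. X q f) else 0)"

section \<open>Tensor fields\<close>

definition lin_on :: "'a::real_vector set \<Rightarrow> ('a \<Rightarrow> 'b::real_vector) \<Rightarrow> bool" where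
  "lin_on S f \<longleftrightarrow> (\<forall>x\<in>S. \<forall>y\<in>S. f (x + y) = f x + f y) \<and> (\<forall>r. \<forall>x\<in>S. f (r *\<^sub>R x) = r *\<^sub>R f x)"

definition one_form :: "'m::topological_space chart set \<Rightarrow> ('m \<Rightarrow> 'm tvec \<Rightarrow> real) \<Rightarrow> bool" where
  "one_form A \<theta> \<longleftrightarrow> (\<forall>p. lin_on (tangent_space A p) (\<theta> p)) \<and>
     (\<forall>U X. open U \<and> smooth_vf A U X \<longrightarrow> smooth_fun A U (\<lambda>q. \<theta> q (X q)))"

definition bilinear_field :: "'m::topological_space chart set \<Rightarrow> ('m \<Rightarrow> 'm tvec \<Rightarrow> 'm tvec \<Rightarrow> real) \<Rightarrow> bool" where
  "bilinear_field A B \<longleftrightarrow>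
     (\<forall>p. \<forall>v\<in>tangent_space A p. lin_on (tangent_space A p) (B p v) \<and>
        lin_on (tangent_space A p) (\<lambda>w. B p w v)) \<and>
     (\<forall>U X Y. open U \<and> smooth_vf A U X \<and> smooth_vf A U Y \<longrightarrow>
        smooth_fun A U (\<lambda>q. B q (X q) (Y q)))"

definition endo_field :: "'m::topological_space chart set \<Rightarrow> ('m \<Rightarrow> 'm tvec \<Rightarrow> 'm tvec) \<Rightarrow> bool" where
  "endo_field A J \<longleftrightarrow>
     (\<forall>p. lin_on (tangent_space A p) (J p) \<and> J p ` tangent_space A p \<subseteq> tangent_space A p) \<and>
     (\<forall>U X. open U \<and> smooth_vf A U X \<longrightarrow> smooth_vf A U (\<lambda>q. J q (X q)))"

definition riemannian_metric :: "'m::topological_space chart set \<Rightarrow> ('m \<Rightarrow> 'm tvec \<Rightarrow> 'm tvec \<Rightarrow> real) \<Rightarrow> bool" where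
  "riemannian_metric A g \<longleftrightarrow> bilinear_field A g \<and>
     (\<forall>p. \<forall>v\<in>tangent_space A p. \<forall>w\<in>tangent_space A p. g p v w = g p w v) \<and>
     (\<forall>p. \<forall>v\<in>tangent_space A p. v \<noteq> 0 \<longrightarrow> g p v v > 0)"

text \<open>The value at \<open>p\<close> of the exterior derivative of a 2-form, on vector fields defined near \<open>p\<close>.
  With the other common normalisation both this and \<open>wedge12\<close> carry a factor \<open>1/3\<close>.\<close>

definition ext_deriv2 :: "'m::topological_space chart set \<Rightarrow> ('m \<Rightarrow> 'm tvec \<Rightarrow> 'm tvec \<Rightarrow> real) \<Rightarrow>
    'm vfield \<Rightarrow> 'm vfield \<Rightarrow> 'm vfield \<Rightarrow> 'm \<Rightarrow> real" where
  "ext_deriv2 A \<Omega> X Y Z p =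
     X p (\<lambda>q. \<Omega> q (Y q) (Z q)) - Y p (\<lambda>q. \<Omega> q (X q) (Z q)) + Z p (\<lambda>q. \<Omega> q (X q) (Y q))
     - \<Omega> p (lie_bracket A X Y p) (Z p) + \<Omega> p (lie_bracket A X Z p) (Y p)
     - \<Omega> p (lie_bracket A Y Z p) (X p)"

definition wedge12 :: "('m \<Rightarrow> 'm tvec \<Rightarrow> real) \<Rightarrow> ('m \<Rightarrow> 'm tvec \<Rightarrow> 'm tvec \<Rightarrow> real) \<Rightarrow>
    'm \<Rightarrow> 'm tvec \<Rightarrow> 'm tvec \<Rightarrow> 'm tvec \<Rightarrow> real" where
  "wedge12 \<theta> \<Omega> p u v w = \<theta> p u * \<Omega> p v w - \<theta> p v * \<Omega> p u w + \<theta> p w * \<Omega> p u v"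

definition lie_deriv_metric :: "'m::topological_space chart set \<Rightarrow> ('m \<Rightarrow> 'm tvec \<Rightarrow> 'm tvec \<Rightarrow> real) \<Rightarrow>
    'm vfield \<Rightarrow> 'm vfield \<Rightarrow> 'm vfield \<Rightarrow> 'm \<Rightarrow> real" where
  "lie_deriv_metric A g V X Y p =
     V p (\<lambda>q. g q (X q) (Y q)) - g p (lie_bracket A V X p) (Y p) - g p (X p) (lie_bracket A V Y p)"

definition lie_deriv_endo :: "'m::topological_space chart set \<Rightarrow> ('m \<Rightarrow> 'm tvec \<Rightarrow> 'm tvec) \<Rightarrow>
    'm vfield \<Rightarrow> 'm vfield \<Rightarrow> 'm vfield" where
  "lie_deriv_endo A J V X = (\<lambda>p. lie_bracket A V (\<lambda>q. J q (X q)) p - J p (lie_bracket A V X p))"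

section \<open>Levi-Civita connection\<close>

text \<open>\<open>nabla Y p v\<close> is the covariant derivative of \<open>Y\<close> at \<open>p\<close> in direction \<open>v\<close>. A connection
  differentiates local sections of the tangent bundle. The values of \<open>Y\<close> off its domain \<open>U\<close> do not
  influence \<open>nabla Y p\<close> for \<open>p \<in> U\<close>: this follows from additivity and the Leibniz rule.\<close>

type_synonym 'm connection = "'m vfield \<Rightarrow> 'm \<Rightarrow> 'm tvec \<Rightarrow> 'm tvec"

definition affine_connection :: "'m::topological_space chart set \<Rightarrow> 'm connection \<Rightarrow> bool" where
  "affine_connection A nabla \<longleftrightarrow> (\<forall>U. open U \<longrightarrow>
     (\<forall>Y p. smooth_vf A U Y \<and> p \<in> U \<longrightarrow>
        lin_on (tangent_space A p) (nabla Y p) \<and> nabla Y p ` tangent_space A p \<subseteq> tangent_space A p) \<and>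
     (\<forall>X Y. smooth_vf A U X \<and> smooth_vf A U Y \<longrightarrow> smooth_vf A U (\<lambda>q. nabla Y q (X q))) \<and>
     (\<forall>Y Z p. smooth_vf A U Y \<and> smooth_vf A U Z \<and> p \<in> U \<longrightarrow>
        (\<forall>v\<in>tangent_space A p. nabla (\<lambda>q. Y q + Z q) p v = nabla Y p v + nabla Z p v)) \<and>
     (\<forall>f Y p. smooth_fun A U f \<and> smooth_vf A U Y \<and> p \<in> U \<longrightarrow>
        (\<forall>v\<in>tangent_space A p. nabla (\<lambda>q. f q *\<^sub>R Y q) p v = v f *\<^sub>R Y p + f p *\<^sub>R nabla Y p v)))"

definition levi_civita :: "'m::topological_space chart set \<Rightarrow> ('m \<Rightarrow> 'm tvec \<Rightarrow> 'm tvec \<Rightarrow> real) \<Rightarrow>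
    'm connection \<Rightarrow> bool" where
  "levi_civita A g nabla \<longleftrightarrow> affine_connection A nabla \<and>
     (\<forall>U X Y p. open U \<and> smooth_vf A U X \<and> smooth_vf A U Y \<and> p \<in> U \<longrightarrow>
        nabla Y p (X p) - nabla X p (Y p) = lie_bracket A X Y p \<and>
        (\<forall>v\<in>tangent_space A p.
           v (\<lambda>q. g q (X q) (Y q)) = g p (nabla X p v) (Y p) + g p (X p) (nabla Y p v)))"

section \<open>Hermitian and Kaehler structures\<close>

definition almost_hermitian :: "'m::topological_space chart set \<Rightarrow> ('m \<Rightarrow> 'm tvec \<Rightarrow> 'm tvec \<Rightarrow> real) \<Rightarrow>
    ('m \<Rightarrow> 'm tvec \<Rightarrow> 'm tvec) \<Rightarrow> bool" where
  "almost_hermitian A g J \<longleftrightarrow> riemannian_metric A g \<and> endo_field A J \<and>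
     (\<forall>p. \<forall>v\<in>tangent_space A p. J p (J p v) = - v) \<and>
     (\<forall>p. \<forall>v\<in>tangent_space A p. \<forall>w\<in>tangent_space A p. g p (J p v) (J p w) = g p v w)"

definition kaehler_form :: "('m \<Rightarrow> 'm tvec \<Rightarrow> 'm tvec \<Rightarrow> real) \<Rightarrow> ('m \<Rightarrow> 'm tvec \<Rightarrow> 'm tvec) \<Rightarrow>
    'm \<Rightarrow> 'm tvec \<Rightarrow> 'm tvec \<Rightarrow> real" where
  "kaehler_form g J p v w = g p (J p v) w"

text \<open>Multiplication by \<open>\<i>\<close> on \<open>\<complex>\<^sup>2\<close> with real coordinates \<open>x\<^sub>1, y\<^sub>1, x\<^sub>2, y\<^sub>2\<close>.\<close>

definition std_J :: "real^4 \<Rightarrow> real^4" where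
  "std_J a = vector [- a$2, a$1, - a$4, a$3]"

text \<open>\<open>J\<close> comes from a complex manifold structure: there are holomorphic coordinates around every
  point.\<close>

definition integrable_complex :: "'m::topological_space chart set \<Rightarrow> ('m \<Rightarrow> 'm tvec \<Rightarrow> 'm tvec) \<Rightarrow> bool" where
  "integrable_complex A J \<longleftrightarrow> (\<forall>p. \<exists>c. admissible A c \<and> p \<in> fst c \<and>
     (\<forall>q\<in>fst c. \<forall>a. J q (coord_vec A c q a) = coord_vec A c q (std_J a)))"

definition closed_2form :: "'m::topological_space chart set \<Rightarrow> ('m \<Rightarrow> 'm tvec \<Rightarrow> 'm tvec \<Rightarrow> real) \<Rightarrow> bool" where
  "closed_2form A \<omega> \<longleftrightarrow> (\<forall>U X Y Z p. open U \<and> smooth_vf A U X \<and> smooth_vf A U Y \<and> smooth_vf A U Z \<and>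
     p \<in> U \<longrightarrow> ext_deriv2 A \<omega> X Y Z p = 0)"

definition kaehler_surface :: "'m::{t2_space,second_countable_topology} chart set \<Rightarrow>
    ('m \<Rightarrow> 'm tvec \<Rightarrow> 'm tvec \<Rightarrow> real) \<Rightarrow> ('m \<Rightarrow> 'm tvec \<Rightarrow> 'm tvec) \<Rightarrow> bool" where
  "kaehler_surface A g J \<longleftrightarrow> connected (UNIV :: 'm set) \<and> is_atlas A \<and>
     almost_hermitian A g J \<and> integrable_complex A J \<and> closed_2form A (kaehler_form g J)"

section \<open>Foliations\<close>

text \<open>\<open>D\<close> is the distribution of vectors tangent to the leaves of a \<open>k\<close>-dimensional foliation:
  around every point there is a chart in which the plaques are the slices parallel to a fixed
  \<open>k\<close>-dimensional subspace \<open>W\<close>.\<close>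

definition foliation :: "'m::topological_space chart set \<Rightarrow> nat \<Rightarrow> ('m \<Rightarrow> 'm tvec set) \<Rightarrow> bool" where
  "foliation A k D \<longleftrightarrow> (\<forall>p. \<exists>c W. admissible A c \<and> p \<in> fst c \<and> subspace W \<and> dim W = k \<and>
     (\<forall>q\<in>fst c. D q = coord_vec A c q ` W))"

definition complex_distribution :: "('m \<Rightarrow> 'm tvec \<Rightarrow> 'm tvec) \<Rightarrow> ('m \<Rightarrow> 'm tvec set) \<Rightarrow> bool" where
  "complex_distribution J D \<longleftrightarrow> (\<forall>p. J p ` D p \<subseteq> D p)"

definition orth_complement :: "'m::topological_space chart set \<Rightarrow> ('m \<Rightarrow> 'm tvec \<Rightarrow> 'm tvec \<Rightarrow> real) \<Rightarrow>
    ('m \<Rightarrow> 'm tvec set) \<Rightarrow> 'm \<Rightarrow> 'm tvec set" where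
  "orth_complement A g D p = {v \<in> tangent_space A p. \<forall>w\<in>D p. g p v w = 0}"

definition sections :: "'m::topological_space chart set \<Rightarrow> ('m \<Rightarrow> 'm tvec set) \<Rightarrow> 'm vfield set" where
  "sections A D = {\<xi>. smooth_vf A UNIV \<xi> \<and> (\<forall>p. \<xi> p \<in> D p)}"

text \<open>In the next two definitions a Lie derivative is evaluated, as a tensor at \<open>p\<close>, on vectors of
  the orthogonal complement at \<open>p\<close>: the arguments are arbitrary smooth extensions of these vectors
  to vector fields near \<open>p\<close>, not necessarily sections of the complement.\<close>

definition conformal_foliation :: "'m::topological_space chart set \<Rightarrow>
    ('m \<Rightarrow> 'm tvec \<Rightarrow> 'm tvec \<Rightarrow> real) \<Rightarrow> ('m \<Rightarrow> 'm tvec set) \<Rightarrow> bool" where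
  "conformal_foliation A g D \<longleftrightarrow> (\<exists>\<alpha>. one_form A \<alpha> \<and>
     (\<forall>p. \<forall>v\<in>orth_complement A g D p. \<alpha> p v = 0) \<and>
     (\<forall>V\<in>sections A D. \<forall>U X Y p. open U \<and> p \<in> U \<and> smooth_vf A U X \<and> smooth_vf A U Y \<and>
        X p \<in> orth_complement A g D p \<and> Y p \<in> orth_complement A g D p \<longrightarrow>
        lie_deriv_metric A g V X Y p = \<alpha> p (V p) * g p (X p) (Y p)))"

definition quasi_holomorphic :: "'m::topological_space chart set \<Rightarrow>
    ('m \<Rightarrow> 'm tvec \<Rightarrow> 'm tvec \<Rightarrow> real) \<Rightarrow> ('m \<Rightarrow> 'm tvec \<Rightarrow> 'm tvec) \<Rightarrow>
    ('m \<Rightarrow> 'm tvec set) \<Rightarrow> bool" where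
  "quasi_holomorphic A g J D \<longleftrightarrow> (\<forall>\<xi>\<in>sections A D. \<forall>U X p.
     open U \<and> p \<in> U \<and> smooth_vf A U X \<and> X p \<in> orth_complement A g D p \<longrightarrow>
     lie_deriv_endo A J \<xi> X p \<in> D p)"

definition J_one_form :: "('m \<Rightarrow> 'm tvec \<Rightarrow> 'm tvec) \<Rightarrow> ('m \<Rightarrow> 'm tvec \<Rightarrow> real) \<Rightarrow> 'm \<Rightarrow> 'm tvec \<Rightarrow> real" where
  "J_one_form J \<theta> p v = - \<theta> p (J p v)"

end

theory Submission
  imports Defs
begin

text \<open>For \<open>\<xi>\<close> tangent to \<open>D\<close> put \<open>B(X, Y) = g(\<nabla>\<^sub>X \<xi>, Y)\<close> on \<open>E\<close>, which is spanned by \<open>X\<close> and \<open>J X\<close> for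
  every \<open>X \<noteq> 0\<close>. Since \<open>\<nabla> J = 0\<close>, quasi holomorphy is \<open>B(J X, Y) + B(X, J Y) = 0\<close> and conformality is
  \<open>B(X, Y) + B(Y, X) = \<alpha>(\<xi>) g(X, Y)\<close>; in two dimensions both say that the trace-free symmetric part of
  \<open>B\<close> vanishes. The equation for \<open>d\<Omega>\<^sub>I\<close> together with \<open>d\<omega> = 0\<close> gives \<open>\<theta> = 0\<close> on \<open>E\<close> and
  \<open>tr B = \<theta>(\<xi>)\<close>. Applied to \<open>J \<xi>\<close> instead of \<open>\<xi>\<close>, the trace formula becomes a formula for the skew
  part of \<open>B\<close>, so all of \<open>B\<close> is determined.\<close>

section \<open>Calculus of smooth maps\<close>

text \<open>A Kaehler surface is given by holomorphic charts and a closed form, so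
  \<open>\<nabla> J = 0\<close> has to be derived. In holomorphic coordinates the fields with
  constant coefficients commute and \<open>J\<close> permutes them, which reduces the claim to an
  algebraic identity between the numbers \<open>g(\<nabla>\<^sub>a X\<^sub>b, X\<^sub>c)\<close>.

  Conditions (a) and (b) are stated for arbitrary local extensions of vectors in \<open>E\<close>.
  Expressed through the connection they become visibly pointwise, so any extension will do. The
  equations for \<open>d\<omega>\<close> and \<open>d\<Omega>\<^sub>I\<close> are instead evaluated
  on well chosen fields: commuting fields tangent to the leaves when \<open>\<theta>\<close> is
  tested on \<open>E\<close>, and fields \<open>X\<close>, \<open>J X\<close> lying in
  \<open>E\<close> near the whole point when the trace is computed, so that mixed terms vanish
  identically.

  The vanishing of \<open>\<theta>\<close> on \<open>E\<close> is what allows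
  \<open>\<theta>\<close> itself to serve as the form \<open>\<alpha>\<close> of a conformal
  foliation. The trace formula may be applied to \<open>J \<xi>\<close> because \<open>D\<close> is
  complex and \<open>J\<close> is smooth, so \<open>J \<xi>\<close> is again a global
  section.\<close>

lemma Ck_on_cong:
  assumes "open S" "\<And>x. x \<in> S \<Longrightarrow> f x = g x" "Ck_on k S f"
  shows "Ck_on k S g"
  using assms(2,3)
proof (induction k arbitrary: f g)
  case 0
  then show ?case
    by (auto cong: continuous_on_cong)
next
  case (Suc k)
  have D: "f differentiable at x" if "x \<in> S" for x
    using Suc.prems that by simp
  have "g differentiable at x" if "x \<in> S" for x
    using D[OF that] Suc.prems(1) assms(1) that
    unfolding differentiable_def by (blast intro: has_derivative_transform_within_open)
  moreover have "Ck_on k S (\<lambda>x. frechet_derivative g (at x) v)" for v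
  proof (rule Suc.IH)
    show "Ck_on k S (\<lambda>x. frechet_derivative f (at x) v)"
      using Suc.prems by simp
    show "frechet_derivative f (at x) v = frechet_derivative g (at x) v" if "x \<in> S" for x
      using frechet_derivative_transform_within_open[OF D[OF that] assms(1) that Suc.prems(1)] by simp
  qed
  ultimately show ?case by simp
qed

text \<open>The derivatives in \<open>Ck_on\<close> are taken in the ambient space and not within
  \<open>S\<close>, so they do not change when the set shrinks.\<close>

lemma Ck_on_subset: "Ck_on k S f \<Longrightarrow> T \<subseteq> S \<Longrightarrow> Ck_on k T f"
  by (induction k arbitrary: f) (auto intro: continuous_on_subset)

lemma Ck_on_SucD: "Ck_on (Suc k) S f \<Longrightarrow> Ck_on k S f"
proof (induction k arbitrary: f)
  case 0
  then show ?case
    by (auto intro!: continuous_at_imp_continuous_on differentiable_imp_continuous_within)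
next
  case (Suc k)
  then show ?case by (metis Ck_on.simps(2))
qed

lemma Ck_on_const: "Ck_on k S (\<lambda>x. c)"
  by (induction k arbitrary: c) auto

lemma Ck_on_bounded_linear:
  fixes h :: "'b::euclidean_space \<Rightarrow> 'c::euclidean_space"
  assumes "open S" "bounded_linear h" "Ck_on k S f"
  shows "Ck_on k S (\<lambda>x. h (f x))"
  using assms(3)
proof (induction k arbitrary: f)
  case 0
  then show ?case using assms(2)
    by (simp add: bounded_linear.continuous_on)
next
  case (Suc k)
  have D: "((\<lambda>x. h (f x)) has_derivative (\<lambda>v. h (frechet_derivative f (at x) v))) (at x)" if "x \<in> S" for x
    using Suc.prems that frechet_derivative_works
    by (intro bounded_linear.has_derivative[OF assms(2)]) auto
  have "Ck_on k S (\<lambda>x. frechet_derivative (\<lambda>x. h (f x)) (at x) v)" for v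
  proof (rule Ck_on_cong[OF assms(1)])
    show "Ck_on k S (\<lambda>x. h (frechet_derivative f (at x) v))"
      using Suc by simp
    show "h (frechet_derivative f (at x) v) = frechet_derivative (\<lambda>x. h (f x)) (at x) v" if "x \<in> S" for x
      by (rule fun_cong[OF frechet_derivative_at[OF D[OF that]]])
  qed
  then show ?case
    using differentiableI[OF D] by simp
qed

lemma Ck_on_add:
  assumes "open S" "Ck_on k S f" "Ck_on k S g"
  shows "Ck_on k S (\<lambda>x. f x + g x)"
  using assms(2,3)
proof (induction k arbitrary: f g)
  case 0
  then show ?case by (simp add: continuous_on_add)
next
  case (Suc k)
  have D: "((\<lambda>x. f x + g x) has_derivative
      (\<lambda>v. frechet_derivative f (at x) v + frechet_derivative g (at x) v)) (at x)" if "x \<in> S" for x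
    using Suc.prems that frechet_derivative_works by (intro has_derivative_add) auto
  have "Ck_on k S (\<lambda>x. frechet_derivative (\<lambda>x. f x + g x) (at x) v)" for v
  proof (rule Ck_on_cong[OF assms(1)])
    show "Ck_on k S (\<lambda>x. frechet_derivative f (at x) v + frechet_derivative g (at x) v)"
      using Suc by simp
    show "frechet_derivative f (at x) v + frechet_derivative g (at x) v =
        frechet_derivative (\<lambda>x. f x + g x) (at x) v" if "x \<in> S" for x
      by (rule fun_cong[OF frechet_derivative_at[OF D[OF that]]])
  qed
  then show ?case
    using differentiableI[OF D] by simp
qed

lemma Ck_on_mult:
  fixes f g :: "'a::euclidean_space \<Rightarrow> real"
  assumes "open S" "Ck_on k S f" "Ck_on k S g"
  shows "Ck_on k S (\<lambda>x. f x * g x)"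
  using assms(2,3)
proof (induction k arbitrary: f g)
  case 0
  then show ?case by (simp add: continuous_on_mult)
next
  case (Suc k)
  have D: "((\<lambda>x. f x * g x) has_derivative
      (\<lambda>v. f x * frechet_derivative g (at x) v + frechet_derivative f (at x) v * g x)) (at x)" if "x \<in> S" for x
    using Suc.prems that frechet_derivative_works by (intro has_derivative_mult) auto
  have "Ck_on k S (\<lambda>x. frechet_derivative (\<lambda>x. f x * g x) (at x) v)" for v
  proof (rule Ck_on_cong[OF assms(1)])
    have 1: "Ck_on k S f" "Ck_on k S g"
      using Suc.prems Ck_on_SucD by blast+
    have 2: "Ck_on k S (\<lambda>x. frechet_derivative f (at x) v)" "Ck_on k S (\<lambda>x. frechet_derivative g (at x) v)"
      using Suc.prems by simp_all
    show "Ck_on k S (\<lambda>x. f x * frechet_derivative g (at x) v + frechet_derivative f (at x) v * g x)"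
      by (rule Ck_on_add[OF assms(1) Suc.IH[OF 1(1) 2(2)] Suc.IH[OF 2(1) 1(2)]])
    show "f x * frechet_derivative g (at x) v + frechet_derivative f (at x) v * g x =
        frechet_derivative (\<lambda>x. f x * g x) (at x) v" if "x \<in> S" for x
      by (rule fun_cong[OF frechet_derivative_at[OF D[OF that]]])
  qed
  then show ?case
    using differentiableI[OF D] by simp
qed

lemma Ck_on_sum:
  assumes "open S" "finite B" "\<And>i. i \<in> B \<Longrightarrow> Ck_on k S (f i)"
  shows "Ck_on k S (\<lambda>x. \<Sum>i\<in>B. f i x)"
  using assms(2,3)
proof (induction B rule: finite_induct)
  case empty
  show ?case using Ck_on_const by simp
next
  case (insert i B)
  then have "Ck_on k S (\<lambda>x. f i x + (\<Sum>i\<in>B. f i x))"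
    by (intro Ck_on_add assms(1)) auto
  then show ?case using insert.hyps by simp
qed

text \<open>The chain rule writes a directional derivative of \<open>g \<circ> f\<close> as a sum of
  components of the derivative of \<open>f\<close> times partial derivatives of \<open>g\<close>
  composed with \<open>f\<close>. The induction varies \<open>g\<close> and keeps \<open>f\<close>,
  so it covers these composites; with \<open>g\<close> real-valued, only products of real functions
  occur.\<close>

lemma Ck_on_compose:
  fixes f :: "'a::euclidean_space \<Rightarrow> 'b::euclidean_space" and g :: "'b \<Rightarrow> real"
  assumes "open S" "open T" "f ` S \<subseteq> T" "Ck_on k S f" "Ck_on k T g"
  shows "Ck_on k S (g \<circ> f)"
  using assms(4,5)
proof (induction k arbitrary: g)
  case 0
  then show ?case
    using assms(3) by (metis Ck_on.simps(1) continuous_on_compose continuous_on_subset)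
next
  case (Suc k)
  have D: "((g \<circ> f) has_derivative
      (\<lambda>v. frechet_derivative g (at (f x)) (frechet_derivative f (at x) v))) (at x)" if "x \<in> S" for x
  proof -
    have "f differentiable at x" "g differentiable at (f x)"
      using Suc.prems that assms(3) by auto
    then show ?thesis
      using diff_chain_at frechet_derivative_works unfolding o_def by metis
  qed
  have "Ck_on k S (\<lambda>x. frechet_derivative (g \<circ> f) (at x) v)" for v
  proof (rule Ck_on_cong[OF assms(1)])
    have "Ck_on k S f"
      using Suc.prems Ck_on_SucD by blast
    then have 1: "Ck_on k S ((\<lambda>y. frechet_derivative g (at y) i) \<circ> f)" for i
      using Suc.prems by (intro Suc.IH) auto
    have "Ck_on k S (\<lambda>x. frechet_derivative f (at x) v)"
      using Suc.prems by simp
    then have 2: "Ck_on k S (\<lambda>x. frechet_derivative f (at x) v \<bullet> i)" for i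
      by (rule Ck_on_bounded_linear[OF assms(1) bounded_linear_inner_left])
    show "Ck_on k S (\<lambda>x. \<Sum>i\<in>Basis. (frechet_derivative f (at x) v \<bullet> i) *
        ((\<lambda>y. frechet_derivative g (at y) i) \<circ> f) x)"
      by (rule Ck_on_sum[OF assms(1) finite_Basis Ck_on_mult[OF assms(1) 2 1]])
    show "(\<Sum>i\<in>Basis. (frechet_derivative f (at x) v \<bullet> i) *
        ((\<lambda>y. frechet_derivative g (at y) i) \<circ> f) x) = frechet_derivative (g \<circ> f) (at x) v" if "x \<in> S" for x
    proof -
      have "g differentiable at (f x)"
        using Suc.prems that assms(3) by auto
      then have lin: "linear (frechet_derivative g (at (f x)))"
        by (rule linear_frechet_derivative)
      have "frechet_derivative (g \<circ> f) (at x) v =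
          frechet_derivative g (at (f x)) (frechet_derivative f (at x) v)"
        by (rule fun_cong[OF sym[OF frechet_derivative_at[OF D[OF that]]]])
      also have "\<dots> = frechet_derivative g (at (f x))
          (\<Sum>i\<in>Basis. (frechet_derivative f (at x) v \<bullet> i) *\<^sub>R i)"
        by (simp add: euclidean_representation)
      also have "\<dots> = (\<Sum>i\<in>Basis. (frechet_derivative f (at x) v \<bullet> i) * frechet_derivative g (at (f x)) i)"
        using lin by (simp add: linear_sum linear_cmul)
      finally show ?thesis by simp
    qed
  qed
  then show ?case
    using differentiableI[OF D] unfolding Ck_on.simps by blast
qed

lemma smooth_on_cong:
  "open S \<Longrightarrow> (\<And>x. x \<in> S \<Longrightarrow> f x = g x) \<Longrightarrow> smooth_on S f \<Longrightarrow> smooth_on S g"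
  unfolding smooth_on_def using Ck_on_cong by metis

lemma smooth_on_subset: "smooth_on S f \<Longrightarrow> T \<subseteq> S \<Longrightarrow> smooth_on T f"
  unfolding smooth_on_def using Ck_on_subset by metis

lemma smooth_on_compose:
  fixes f :: "'a::euclidean_space \<Rightarrow> 'b::euclidean_space" and g :: "'b \<Rightarrow> real"
  shows "open S \<Longrightarrow> open T \<Longrightarrow> f ` S \<subseteq> T \<Longrightarrow> smooth_on S f \<Longrightarrow> smooth_on T g \<Longrightarrow> smooth_on S (g \<circ> f)"
  unfolding smooth_on_def using Ck_on_compose by metis

lemma smooth_on_differentiable: "smooth_on S f \<Longrightarrow> x \<in> S \<Longrightarrow> f differentiable at x"
  unfolding smooth_on_def using Ck_on.simps(2) by metis

lemma smooth_on_frechet_derivative: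
  "smooth_on S f \<Longrightarrow> smooth_on S (\<lambda>x. frechet_derivative f (at x) v)"
  unfolding smooth_on_def using Ck_on.simps(2) by metis

lemma smooth_on_imp_continuous_on: "smooth_on S f \<Longrightarrow> continuous_on S f"
  unfolding smooth_on_def using Ck_on.simps(1) by metis

section \<open>Symmetry of second derivatives\<close>

lemma second_difference_mean_value:
  fixes f :: "'a::euclidean_space \<Rightarrow> real"
  assumes f: "smooth_on S f" and s: "s > 0"
    and sub: "\<And>t r. \<lbrakk>0 \<le> t; t \<le> s; 0 \<le> r; r \<le> s\<rbrakk> \<Longrightarrow> x + t *\<^sub>R a + r *\<^sub>R b \<in> S"
  obtains t r where "0 < t" "t < s" "0 < r" "r < s"
    "f (x + s *\<^sub>R a + s *\<^sub>R b) - f (x + s *\<^sub>R a) - f (x + s *\<^sub>R b) + f x =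
      s * s * frechet_derivative (\<lambda>y. frechet_derivative f (at y) a) (at (x + t *\<^sub>R a + r *\<^sub>R b)) b"
proof -
  have line: "((\<lambda>t. h (y + t *\<^sub>R w)) has_field_derivative frechet_derivative h (at (y + t *\<^sub>R w)) w) (at t)"
    if "h differentiable at (y + t *\<^sub>R w)" for h :: "'a \<Rightarrow> real" and y w t
  proof -
    have "((\<lambda>t. h (y + t *\<^sub>R w)) has_derivative (\<lambda>d. frechet_derivative h (at (y + t *\<^sub>R w)) (d *\<^sub>R w))) (at t)"
    proof -
      have "((\<lambda>t. y + t *\<^sub>R w) has_derivative (\<lambda>d. d *\<^sub>R w)) (at t)"
        by (auto intro!: derivative_eq_intros)
      moreover have "(h has_derivative frechet_derivative h (at (y + t *\<^sub>R w))) (at (y + t *\<^sub>R w))"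
        using that frechet_derivative_works by blast
      ultimately show ?thesis
        using diff_chain_at[of "\<lambda>t. y + t *\<^sub>R w"] by (simp add: o_def)
    qed
    then show ?thesis
      unfolding has_field_derivative_def
      by (rule has_derivative_eq_rhs) (simp add: fun_eq_iff linear_cmul[OF linear_frechet_derivative[OF that]] mult.commute)
  qed
  define F where "F = (\<lambda>y. frechet_derivative f (at y) a)"
  have F: "smooth_on S F"
    unfolding F_def by (rule smooth_on_frechet_derivative[OF f])
  \<comment> \<open>The mean value theorem is applied along \<open>a\<close> to the increment of
    \<open>f\<close> in direction \<open>s b\<close>. It yields an increment of \<open>F\<close> in
    direction \<open>s b\<close>, to which it is applied once more along \<open>b\<close>.\<close>
  have "((\<lambda>t. f (x + t *\<^sub>R a + s *\<^sub>R b) - f (x + t *\<^sub>R a)) has_field_derivative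
      F (x + t *\<^sub>R a + s *\<^sub>R b) - F (x + t *\<^sub>R a)) (at t)" if "0 \<le> t" "t \<le> s" for t
  proof -
    have "x + t *\<^sub>R a + s *\<^sub>R b \<in> S" "x + t *\<^sub>R a \<in> S"
      using sub[of t s] sub[of t 0] that s by auto
    then show ?thesis
      using line[of f "x + s *\<^sub>R b" t a] line[of f x t a] smooth_on_differentiable[OF f]
      unfolding F_def by (intro DERIV_diff) (auto simp: algebra_simps)
  qed
  then obtain t where t: "0 < t" "t < s" and
    1: "f (x + s *\<^sub>R a + s *\<^sub>R b) - f (x + s *\<^sub>R a) - (f (x + s *\<^sub>R b) - f x) =
      s * (F (x + t *\<^sub>R a + s *\<^sub>R b) - F (x + t *\<^sub>R a))"
    using MVT2[OF s, of "\<lambda>t. f (x + t *\<^sub>R a + s *\<^sub>R b) - f (x + t *\<^sub>R a)"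
        "\<lambda>t. F (x + t *\<^sub>R a + s *\<^sub>R b) - F (x + t *\<^sub>R a)"] by auto
  have "((\<lambda>r. F (x + t *\<^sub>R a + r *\<^sub>R b)) has_field_derivative
      frechet_derivative F (at (x + t *\<^sub>R a + r *\<^sub>R b)) b) (at r)" if "0 \<le> r" "r \<le> s" for r
    using line sub[of t r] t that smooth_on_differentiable[OF F] by auto
  then obtain r where r: "0 < r" "r < s" and
    2: "F (x + t *\<^sub>R a + s *\<^sub>R b) - F (x + t *\<^sub>R a) = s * frechet_derivative F (at (x + t *\<^sub>R a + r *\<^sub>R b)) b"
    using MVT2[OF s, of "\<lambda>r. F (x + t *\<^sub>R a + r *\<^sub>R b)"
        "\<lambda>r. frechet_derivative F (at (x + t *\<^sub>R a + r *\<^sub>R b)) b"] by auto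
  show ?thesis
    using that[OF t r] 1 2 unfolding F_def by (simp add: algebra_simps)
qed

text \<open>The second difference over a small parallelogram is symmetric in \<open>a\<close> and
  \<open>b\<close>. By the mean value form it equals \<open>s * s\<close> times a value of either
  mixed derivative near \<open>x\<close>, and continuity of both then compares their values at
  \<open>x\<close>.\<close>

lemma smooth_on_second_derivative_symmetric:
  fixes f :: "'a::euclidean_space \<Rightarrow> real"
  assumes S: "open S" and f: "smooth_on S f" and x: "x \<in> S"
  shows "frechet_derivative (\<lambda>y. frechet_derivative f (at y) a) (at x) b =
    frechet_derivative (\<lambda>y. frechet_derivative f (at y) b) (at x) a"
proof -
  define P where "P = (\<lambda>y. frechet_derivative (\<lambda>y. frechet_derivative f (at y) a) (at y) b)"
  define Q where "Q = (\<lambda>y. frechet_derivative (\<lambda>y. frechet_derivative f (at y) b) (at y) a)"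
  have cont: "isCont P x" "isCont Q x"
    unfolding P_def Q_def using S x
    using smooth_on_imp_continuous_on[OF smooth_on_frechet_derivative[OF smooth_on_frechet_derivative[OF f]]]
    by (auto simp: continuous_on_eq_continuous_at[OF S])
  have "\<bar>P x - Q x\<bar> \<le> 2 * e" if e: "e > 0" for e
  proof -
    obtain d1 where d1: "d1 > 0" "\<And>y. dist y x < d1 \<Longrightarrow> \<bar>P y - P x\<bar> < e"
      using cont(1) e unfolding continuous_at_eps_delta by (auto simp: dist_norm)
    obtain d2 where d2: "d2 > 0" "\<And>y. dist y x < d2 \<Longrightarrow> \<bar>Q y - Q x\<bar> < e"
      using cont(2) e unfolding continuous_at_eps_delta by (auto simp: dist_norm)
    obtain d3 where d3: "d3 > 0" "ball x d3 \<subseteq> S"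
      using S x openE by blast
    define d where "d = min d1 (min d2 d3)"
    \<comment> \<open>With this side length the whole parallelogram stays within distance
      \<open>d\<close> of \<open>x\<close>; the summand 1 keeps the denominator positive when
      \<open>a\<close> and \<open>b\<close> both vanish.\<close>
    define s where "s = d / (norm a + norm b + 1)"
    have d: "d > 0"
      using d1 d2 d3 by (simp add: d_def)
    then have s: "s > 0"
      by (simp add: s_def add_nonneg_pos)
    have near: "dist (x + t *\<^sub>R a + r *\<^sub>R b) x < d" if "0 \<le> t" "t \<le> s" "0 \<le> r" "r \<le> s" for t r
    proof -
      have "dist (x + t *\<^sub>R a + r *\<^sub>R b) x \<le> norm (t *\<^sub>R a) + norm (r *\<^sub>R b)"
        using norm_triangle_ineq[of "t *\<^sub>R a" "r *\<^sub>R b"] by (simp add: dist_norm add.assoc)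
      also have "\<dots> \<le> s * norm a + s * norm b"
        using that by (intro add_mono) (auto simp: mult_right_mono)
      also have "\<dots> < s * (norm a + norm b + 1)"
        using s by (simp add: algebra_simps)
      also have "\<dots> = d"
        unfolding s_def using norm_ge_zero[of a] norm_ge_zero[of b] by (simp add: add_nonneg_eq_0_iff)
      finally show ?thesis .
    qed
    have sub: "x + t *\<^sub>R a + r *\<^sub>R b \<in> S" if "0 \<le> t" "t \<le> s" "0 \<le> r" "r \<le> s" for t r
      using near[OF that] d3 by (auto simp: d_def dist_commute)
    obtain t r where tr: "0 < t" "t < s" "0 < r" "r < s" and
      1: "f (x + s *\<^sub>R a + s *\<^sub>R b) - f (x + s *\<^sub>R a) - f (x + s *\<^sub>R b) + f x =
        s * s * P (x + t *\<^sub>R a + r *\<^sub>R b)"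
      using second_difference_mean_value[OF f s sub] unfolding P_def by blast
    have sub': "x + r *\<^sub>R b + t *\<^sub>R a \<in> S" if "0 \<le> r" "r \<le> s" "0 \<le> t" "t \<le> s" for t r
      using sub[of t r] that by (simp add: algebra_simps)
    obtain t' r' where tr': "0 < t'" "t' < s" "0 < r'" "r' < s" and
      2: "f (x + s *\<^sub>R b + s *\<^sub>R a) - f (x + s *\<^sub>R b) - f (x + s *\<^sub>R a) + f x =
        s * s * Q (x + t' *\<^sub>R b + r' *\<^sub>R a)"
      using second_difference_mean_value[OF f s sub'] unfolding Q_def by blast
    have "x + t' *\<^sub>R b + r' *\<^sub>R a = x + r' *\<^sub>R a + t' *\<^sub>R b"
      by simp
    then have "s * s * P (x + t *\<^sub>R a + r *\<^sub>R b) = s * s * Q (x + r' *\<^sub>R a + t' *\<^sub>R b)"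
      using 1 2 by (simp add: algebra_simps)
    then have "P (x + t *\<^sub>R a + r *\<^sub>R b) = Q (x + r' *\<^sub>R a + t' *\<^sub>R b)"
      using s by simp
    moreover have "\<bar>P (x + t *\<^sub>R a + r *\<^sub>R b) - P x\<bar> < e"
      using d1 near[of t r] tr by (simp add: d_def)
    moreover have "\<bar>Q (x + r' *\<^sub>R a + t' *\<^sub>R b) - Q x\<bar> < e"
      using d2 near[of r' t'] tr' by (simp add: d_def)
    ultimately show ?thesis by linarith
  qed
  \<comment> \<open>For this \<open>e\<close> the bound says that the difference is at most half of
    itself.\<close>
  from this[of "\<bar>P x - Q x\<bar> / 4"] have "P x = Q x"
    by (cases "P x = Q x") auto
  then show ?thesis
    by (simp add: P_def Q_def)
qed

section \<open>Closure properties and locality of smoothness\<close>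

lemma smooth_on_add:
  "open S \<Longrightarrow> smooth_on S f \<Longrightarrow> smooth_on S g \<Longrightarrow> smooth_on S (\<lambda>x. f x + g x)"
  unfolding smooth_on_def using Ck_on_add by blast

lemma smooth_on_bounded_linear:
  fixes h :: "'b::euclidean_space \<Rightarrow> 'c::euclidean_space"
  shows "open S \<Longrightarrow> bounded_linear h \<Longrightarrow> smooth_on S f \<Longrightarrow> smooth_on S (\<lambda>x. h (f x))"
  unfolding smooth_on_def using Ck_on_bounded_linear by blast

lemma smooth_on_local:
  assumes "\<And>x. x \<in> S \<Longrightarrow> \<exists>T. open T \<and> x \<in> T \<and> smooth_on T f"
  shows "smooth_on S f"
proof -
  have "Ck_on k S f" if "\<And>x. x \<in> S \<Longrightarrow> \<exists>T. open T \<and> x \<in> T \<and> Ck_on k T f" for k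
    using that
  proof (induction k arbitrary: f)
    case 0
    then have "isCont f x" if "x \<in> S" for x
      using that by (metis Ck_on.simps(1) continuous_on_eq_continuous_at)
    then show ?case
      by (simp add: continuous_at_imp_continuous_on)
  next
    case (Suc k)
    have "Ck_on k S (\<lambda>x. frechet_derivative f (at x) v)" for v
      by (rule Suc.IH) (metis Suc.prems Ck_on.simps(2))
    moreover have "f differentiable at x" if "x \<in> S" for x
      using Suc.prems that by (metis Ck_on.simps(2))
    ultimately show ?case by simp
  qed
  then show ?thesis
    using assms unfolding smooth_on_def by metis
qed

section \<open>Smooth functions and tangent vectors in charts\<close>

lemma chart_inv_left: "is_chart c \<Longrightarrow> p \<in> fst c \<Longrightarrow> chart_inv c (snd c p) = p"
  unfolding is_chart_def homeomorphism_def by auto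

lemma open_chart_image:
  assumes "is_chart c" "open V"
  shows "open (snd c ` (V \<inter> fst c))"
proof -
  have "openin (top_of_set (fst c)) (V \<inter> fst c)"
    using assms(2) unfolding openin_open by (intro exI[of _ V]) auto
  then have "openin (top_of_set (snd c ` fst c)) (snd c ` (V \<inter> fst c))"
    using assms(1) homeomorphism_imp_open_map unfolding is_chart_def by blast
  then show ?thesis
    using assms(1) openin_open_trans unfolding is_chart_def by blast
qed

lemma smooth_fun_subset: "smooth_fun A V f \<Longrightarrow> U \<subseteq> V \<Longrightarrow> smooth_fun A U f"
  unfolding smooth_fun_def by (meson Int_mono image_mono order_refl smooth_on_subset)

lemma smooth_vf_subset: "smooth_vf A V X \<Longrightarrow> U \<subseteq> V \<Longrightarrow> smooth_vf A U X"
  unfolding smooth_vf_def by (meson subset_iff subset_trans)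

lemma smooth_vf_tangent: "smooth_vf A U X \<Longrightarrow> p \<in> U \<Longrightarrow> X p \<in> tangent_space A p"
  unfolding smooth_vf_def by blast

locale smooth_manifold =
  fixes A :: "'m::topological_space chart set"
  assumes atlas: "is_atlas A"
begin

lemma admissible_atlas: "c \<in> A \<Longrightarrow> admissible A c"
  using atlas unfolding is_atlas_def admissible_def by blast

lemma obtain_atlas_chart:
  obtains c where "c \<in> A" "p \<in> fst c"
  using atlas unfolding is_atlas_def by blast

lemma open_chart_domain: "admissible A c \<Longrightarrow> open (fst c)"
  unfolding admissible_def is_chart_def by blast

lemma admissible_is_chart: "admissible A c \<Longrightarrow> is_chart c"
  unfolding admissible_def by blast

lemma transition_smooth:
  assumes "admissible A c" "d \<in> A"
  shows "smooth_on (snd c ` (fst c \<inter> fst d)) (snd d \<circ> chart_inv c)"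
    and "smooth_on (snd d ` (fst c \<inter> fst d)) (snd c \<circ> chart_inv d)"
  using assms unfolding admissible_def compatible_def by blast+

text \<open>\<open>smooth_fun\<close> tests atlas charts only, whereas holomorphic and foliation
  charts are merely admissible. Near each point the representation in \<open>c\<close> is the one in
  an atlas chart followed by a smooth transition map, and smoothness is local.\<close>

lemma smooth_fun_in_chart:
  assumes f: "smooth_fun A V f" and V: "open V" and c: "admissible A c"
  shows "smooth_on (snd c ` (V \<inter> fst c)) (f \<circ> chart_inv c)"
proof (rule smooth_on_local)
  fix x assume "x \<in> snd c ` (V \<inter> fst c)"
  then obtain q where q: "q \<in> V" "q \<in> fst c" "x = snd c q" by blast
  obtain d where d: "d \<in> A" "q \<in> fst d"
    using obtain_atlas_chart by blast
  note d_chart = admissible_is_chart[OF admissible_atlas[OF d(1)]]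
  note c_chart = admissible_is_chart[OF c]
  define T where "T = snd c ` ((V \<inter> fst d) \<inter> fst c)"
  have T: "open T"
    unfolding T_def using V open_chart_domain[OF admissible_atlas[OF d(1)]] c_chart
    by (intro open_chart_image) auto
  have "smooth_on T ((f \<circ> chart_inv d) \<circ> (snd d \<circ> chart_inv c))"
  proof (rule smooth_on_compose[OF T])
    show "open (snd d ` (V \<inter> fst d))"
      using open_chart_image[OF d_chart V] .
    show "(snd d \<circ> chart_inv c) ` T \<subseteq> snd d ` (V \<inter> fst d)"
      unfolding T_def using chart_inv_left[OF c_chart] by auto
    show "smooth_on T (snd d \<circ> chart_inv c)"
      by (rule smooth_on_subset[OF transition_smooth(1)[OF c d(1)]]) (auto simp: T_def)
    show "smooth_on (snd d ` (V \<inter> fst d)) (f \<circ> chart_inv d)"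
      using f d(1) unfolding smooth_fun_def by blast
  qed
  then have "smooth_on T (f \<circ> chart_inv c)"
    by (rule smooth_on_cong[OF T, rotated])
       (auto simp: T_def chart_inv_left[OF c_chart] chart_inv_left[OF d_chart])
  then show "\<exists>T. open T \<and> x \<in> T \<and> smooth_on T (f \<circ> chart_inv c)"
    using T q d unfolding T_def by blast
qed

lemma smooth_fun_of_chart:
  assumes c: "admissible A c" and V: "open V" "V \<subseteq> fst c" and F: "smooth_on (snd c ` V) F"
  shows "smooth_fun A V (\<lambda>q. F (snd c q))"
  unfolding smooth_fun_def
proof
  fix d assume d: "d \<in> A"
  note c_chart = admissible_is_chart[OF c]
  have "smooth_on (snd d ` (V \<inter> fst d)) (F \<circ> (snd c \<circ> chart_inv d))"
  proof (rule smooth_on_compose)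
    show "open (snd d ` (V \<inter> fst d))"
      using open_chart_image[OF admissible_is_chart[OF admissible_atlas[OF d]] V(1)] .
    show "open (snd c ` V)"
      using open_chart_image[OF c_chart V(1)] V(2) by (simp add: Int_absorb2)
    show "(snd c \<circ> chart_inv d) ` (snd d ` (V \<inter> fst d)) \<subseteq> snd c ` V"
      using chart_inv_left[OF admissible_is_chart[OF admissible_atlas[OF d]]] by auto
    show "smooth_on (snd d ` (V \<inter> fst d)) (snd c \<circ> chart_inv d)"
      by (rule smooth_on_subset[OF transition_smooth(2)[OF c d]]) (use V(2) in auto)
  qed (rule F)
  then show "smooth_on (snd d ` (V \<inter> fst d)) ((\<lambda>q. F (snd c q)) \<circ> chart_inv d)"
    by (simp add: o_def)
qed

lemma smooth_fun_cong:
  assumes "open V" "\<And>q. q \<in> V \<Longrightarrow> f q = h q" "smooth_fun A V f"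
  shows "smooth_fun A V h"
  unfolding smooth_fun_def
proof
  fix c assume c: "c \<in> A"
  note c_chart = admissible_is_chart[OF admissible_atlas[OF c]]
  show "smooth_on (snd c ` (V \<inter> fst c)) (h \<circ> chart_inv c)"
  proof (rule smooth_on_cong[OF open_chart_image[OF c_chart assms(1)]])
    show "smooth_on (snd c ` (V \<inter> fst c)) (f \<circ> chart_inv c)"
      using assms(3) c unfolding smooth_fun_def by blast
  qed (use assms(2) chart_inv_left[OF c_chart] in auto)
qed

lemma smooth_fun_add:
  assumes "open V" "smooth_fun A V f" "smooth_fun A V h"
  shows "smooth_fun A V (\<lambda>q. f q + h q)"
  unfolding smooth_fun_def
proof
  fix c assume c: "c \<in> A"
  show "smooth_on (snd c ` (V \<inter> fst c)) ((\<lambda>q. f q + h q) \<circ> chart_inv c)"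
    using smooth_on_add[OF open_chart_image[OF admissible_is_chart[OF admissible_atlas[OF c]] assms(1)],
        of "f \<circ> chart_inv c" "h \<circ> chart_inv c"] assms(2,3) c
    by (simp add: smooth_fun_def o_def)
qed

lemma smooth_fun_scale:
  assumes "open V" "smooth_fun A V f"
  shows "smooth_fun A V (\<lambda>q. r * f q)"
  unfolding smooth_fun_def
proof
  fix c assume c: "c \<in> A"
  show "smooth_on (snd c ` (V \<inter> fst c)) ((\<lambda>q. r * f q) \<circ> chart_inv c)"
    using smooth_on_bounded_linear[OF open_chart_image[OF admissible_is_chart[OF admissible_atlas[OF c]] assms(1)]
        bounded_linear_mult_right[of r], of "f \<circ> chart_inv c"] assms(2) c
    by (simp add: smooth_fun_def o_def)
qed

lemma smooth_nearI: "open U \<Longrightarrow> p \<in> U \<Longrightarrow> smooth_fun A U f \<Longrightarrow> smooth_near A p f"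
  unfolding smooth_near_def by blast

lemma smooth_near_cong:
  assumes "open U" "p \<in> U" "\<And>q. q \<in> U \<Longrightarrow> f q = h q" "smooth_near A p f"
  shows "smooth_near A p h"
proof -
  obtain V where V: "open V" "p \<in> V" "smooth_fun A V f"
    using assms(4) unfolding smooth_near_def by blast
  have "smooth_fun A (U \<inter> V) f"
    using V(3) by (rule smooth_fun_subset) blast
  then have "smooth_fun A (U \<inter> V) h"
    by (rule smooth_fun_cong[rotated 2]) (use V assms in auto)
  then show ?thesis
    using V assms by (intro smooth_nearI[of "U \<inter> V"]) auto
qed

lemma smooth_near_scale: "smooth_near A p f \<Longrightarrow> smooth_near A p (\<lambda>q. r * f q)"
  unfolding smooth_near_def using smooth_fun_scale by blast

lemma smooth_near_differentiable:
  assumes "smooth_near A p f" "admissible A c" "p \<in> fst c"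
  shows "(f \<circ> chart_inv c) differentiable at (snd c p)"
proof -
  obtain U where "open U" "p \<in> U" "smooth_fun A U f"
    using assms(1) unfolding smooth_near_def by blast
  then show ?thesis
    using smooth_fun_in_chart assms(2,3) by (blast intro: smooth_on_differentiable)
qed

lemma coord_vec_linear:
  assumes "admissible A c" "p \<in> fst c"
  shows "linear (coord_vec A c p)"
proof -
  have lin: "linear (frechet_derivative (f \<circ> chart_inv c) (at (snd c p)))" if "smooth_near A p f" for f
    using smooth_near_differentiable[OF that assms] by (rule linear_frechet_derivative)
  show ?thesis
    by (rule linearI)
       (auto simp: coord_vec_def fun_eq_iff scaleR_fun_def linear_add[OF lin] linear_cmul[OF lin])
qed

text \<open>This is the chain rule for the transition map. On functions that are not smooth near
  \<open>p\<close> both sides are 0 by convention.\<close>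

lemma coord_vec_change:
  assumes c: "admissible A c" "p \<in> fst c" and d: "admissible A d" "p \<in> fst d"
    and cd: "compatible c d"
  shows "coord_vec A c p a = coord_vec A d p (frechet_derivative (snd d \<circ> chart_inv c) (at (snd c p)) a)"
proof
  fix f
  note c_chart = admissible_is_chart[OF c(1)] and d_chart = admissible_is_chart[OF d(1)]
  show "coord_vec A c p a f =
      coord_vec A d p (frechet_derivative (snd d \<circ> chart_inv c) (at (snd c p)) a) f"
  proof (cases "smooth_near A p f")
    case True
    let ?S = "snd c ` (fst d \<inter> fst c)"
    have S: "open ?S" "snd c p \<in> ?S"
      using open_chart_image[OF c_chart open_chart_domain[OF d(1)]] c d by auto
    have t: "(snd d \<circ> chart_inv c) differentiable at (snd c p)"
      using cd S(2) unfolding compatible_def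
      by (intro smooth_on_differentiable[of "snd c ` (fst c \<inter> fst d)"]) (auto simp: Int_commute)
    have f: "(f \<circ> chart_inv d) differentiable at ((snd d \<circ> chart_inv c) (snd c p))"
      using smooth_near_differentiable[OF True d] chart_inv_left[OF c_chart c(2)] by simp
    have "frechet_derivative (f \<circ> chart_inv c) (at (snd c p)) =
        frechet_derivative ((f \<circ> chart_inv d) \<circ> (snd d \<circ> chart_inv c)) (at (snd c p))"
      using smooth_near_differentiable[OF True c] S
      by (rule frechet_derivative_transform_within_open)
         (auto simp: chart_inv_left[OF c_chart] chart_inv_left[OF d_chart])
    also have "\<dots> = frechet_derivative (f \<circ> chart_inv d) (at ((snd d \<circ> chart_inv c) (snd c p)))
        \<circ> frechet_derivative (snd d \<circ> chart_inv c) (at (snd c p))"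
      by (rule frechet_derivative_compose[OF t f])
    finally show ?thesis
      using True chart_inv_left[OF c_chart c(2)] by (simp add: coord_vec_def)
  qed (simp add: coord_vec_def)
qed

lemma tangent_space_chart:
  assumes "admissible A c" "p \<in> fst c"
  shows "tangent_space A p = range (coord_vec A c p)"
proof
  show "tangent_space A p \<subseteq> range (coord_vec A c p)"
  proof
    fix v assume "v \<in> tangent_space A p"
    then obtain d a where d: "d \<in> A" "p \<in> fst d" "v = coord_vec A d p a"
      unfolding tangent_space_def by blast
    moreover have "compatible d c"
      using assms(1) d(1) unfolding admissible_def compatible_def by (auto simp: Int_commute)
    ultimately show "v \<in> range (coord_vec A c p)"
      using coord_vec_change[OF admissible_atlas[OF d(1)] d(2) assms] by auto
  qed
  obtain d where d: "d \<in> A" "p \<in> fst d"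
    using obtain_atlas_chart by blast
  moreover have "compatible c d"
    using assms(1) d(1) unfolding admissible_def by blast
  ultimately show "range (coord_vec A c p) \<subseteq> tangent_space A p"
    using coord_vec_change[OF assms admissible_atlas[OF d(1)] d(2)]
    unfolding tangent_space_def by blast
qed

lemma subspace_tangent_space: "subspace (tangent_space A p)"
proof -
  obtain c where "c \<in> A" "p \<in> fst c"
    using obtain_atlas_chart by blast
  then show ?thesis
    using linear_subspace_image[OF coord_vec_linear subspace_UNIV] tangent_space_chart admissible_atlas
    by metis
qed

text \<open>The vector with coefficients \<open>a\<close> is tested on the linear coordinate
  function with gradient \<open>a\<close>, where it takes the value
  \<open>a \<bullet> a\<close>.\<close>

lemma coord_vec_eq_0_iff:
  assumes c: "admissible A c" "p \<in> fst c"
  shows "coord_vec A c p a = 0 \<longleftrightarrow> a = 0"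
proof
  assume 0: "coord_vec A c p a = 0"
  let ?S = "snd c ` fst c"
  note c_chart = admissible_is_chart[OF c(1)]
  have "smooth_on ?S (\<lambda>x. x)"
  proof -
    have "Ck_on k ?S (\<lambda>x. x)" for k
      by (cases k) (auto simp: Ck_on_const)
    then show ?thesis
      unfolding smooth_on_def by blast
  qed
  moreover have S: "open ?S"
    using c_chart unfolding is_chart_def by blast
  ultimately have "smooth_on ?S (\<lambda>x. x \<bullet> a)"
    by (rule smooth_on_bounded_linear[rotated 2, OF _ _ bounded_linear_inner_left])
  then have "smooth_near A p (\<lambda>q. snd c q \<bullet> a)"
    using open_chart_domain[OF c(1)] c
    by (intro smooth_nearI[of "fst c"] smooth_fun_of_chart[where F = "\<lambda>x. x \<bullet> a"]) auto
  moreover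
  have "((\<lambda>q. snd c q \<bullet> a) \<circ> chart_inv c has_derivative (\<lambda>x. x \<bullet> a)) (at (snd c p))"
  proof (rule has_derivative_transform_within_open)
    show "((\<lambda>x. x \<bullet> a) has_derivative (\<lambda>x. x \<bullet> a)) (at (snd c p))"
      by (auto intro!: derivative_eq_intros)
  qed (use S c chart_inv_left[OF c_chart] in auto)
  moreover note frechet_derivative_at[OF this, symmetric]
  ultimately have "coord_vec A c p a (\<lambda>q. snd c q \<bullet> a) = a \<bullet> a"
    by (simp add: coord_vec_def)
  then show "a = 0"
    using 0 by simp
qed (use linear_0[OF coord_vec_linear[OF c]] in simp)

text \<open>Smoothness near \<open>p\<close> depends only on the germ, and tangent vectors are 0 on
  all other functions; so locality holds for arbitrary functions.\<close>

lemma tangent_vector_cong: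
  assumes v: "v \<in> tangent_space A p" and U: "open U" "p \<in> U" and eq: "\<And>q. q \<in> U \<Longrightarrow> f q = h q"
  shows "v f = v h"
proof -
  obtain c a where c: "c \<in> A" "p \<in> fst c" "v = coord_vec A c p a"
    using v unfolding tangent_space_def by blast
  note c_chart = admissible_is_chart[OF admissible_atlas[OF c(1)]]
  have iff: "smooth_near A p f \<longleftrightarrow> smooth_near A p h"
    using smooth_near_cong[OF U] eq by metis
  show ?thesis
  proof (cases "smooth_near A p f")
    case True
    have "frechet_derivative (f \<circ> chart_inv c) (at (snd c p)) = frechet_derivative (h \<circ> chart_inv c) (at (snd c p))"
    proof (rule frechet_derivative_transform_within_open)
      show "(f \<circ> chart_inv c) differentiable at (snd c p)"
        by (rule smooth_near_differentiable[OF True admissible_atlas[OF c(1)] c(2)])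
      show "open (snd c ` (U \<inter> fst c))"
        by (rule open_chart_image[OF c_chart U(1)])
    qed (use U c eq chart_inv_left[OF c_chart] in auto)
    then show ?thesis
      using iff c(3) by (simp add: coord_vec_def)
  qed (use iff c(3) in \<open>simp add: coord_vec_def\<close>)
qed

lemma tangent_vector_scale:
  assumes v: "v \<in> tangent_space A p" and "smooth_near A p f"
  shows "v (\<lambda>q. r * f q) = r * v f"
proof -
  obtain c a where c: "c \<in> A" "p \<in> fst c" "v = coord_vec A c p a"
    using v unfolding tangent_space_def by blast
  have "((\<lambda>q. r * f q) \<circ> chart_inv c has_derivative
      (\<lambda>x. r * frechet_derivative (f \<circ> chart_inv c) (at (snd c p)) x)) (at (snd c p))"
    using has_derivative_mult_right[OF
        smooth_near_differentiable[OF assms(2) admissible_atlas[OF c(1)] c(2), unfolded frechet_derivative_works]]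
    by (simp add: o_def)
  from frechet_derivative_at[OF this, symmetric] show ?thesis
    using assms(2) smooth_near_scale[OF assms(2)] c(3) by (simp add: coord_vec_def)
qed

text \<open>If the zero function is smooth near \<open>p\<close>, homogeneity with factor 0 applies;
  in the other case the default value of a tangent vector does.\<close>

lemma tangent_vector_0:
  assumes v: "v \<in> tangent_space A p"
  shows "v (\<lambda>q. 0) = 0"
proof (cases "smooth_near A p (\<lambda>q. 0)")
  case True
  then show ?thesis
    using tangent_vector_scale[OF v True, of 0] by simp
next
  case False
  then show ?thesis
    using v unfolding tangent_space_def coord_vec_def by auto
qed

section \<open>Vector fields\<close>

lemma smooth_vf_add:
  assumes "smooth_vf A U X" "smooth_vf A U Y"
  shows "smooth_vf A U (\<lambda>q. X q + Y q)"
  using assms subspace_add[OF subspace_tangent_space] smooth_fun_add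
  unfolding smooth_vf_def by simp

lemma smooth_vf_scale:
  assumes "smooth_vf A U X"
  shows "smooth_vf A U (\<lambda>q. r *\<^sub>R X q)"
  using assms subspace_scale[OF subspace_tangent_space] smooth_fun_scale
  unfolding smooth_vf_def scaleR_fun_def by simp

lemma smooth_vf_coord_vec:
  assumes c: "admissible A c"
  shows "smooth_vf A (fst c) (\<lambda>q. coord_vec A c q a)"
  unfolding smooth_vf_def
proof (intro conjI allI impI ballI)
  show "coord_vec A c p a \<in> tangent_space A p" if "p \<in> fst c" for p
    using tangent_space_chart[OF c that] by simp
  fix V f assume V: "open V \<and> V \<subseteq> fst c \<and> smooth_fun A V f"
  have "smooth_on (snd c ` V) (f \<circ> chart_inv c)"
    using smooth_fun_in_chart[of V f c] V c by (simp add: Int_absorb2)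
  then have "smooth_fun A V (\<lambda>q. frechet_derivative (f \<circ> chart_inv c) (at (snd c q)) a)"
    using V c by (intro smooth_fun_of_chart[where F = "\<lambda>x. frechet_derivative (f \<circ> chart_inv c) (at x) a"]
        smooth_on_frechet_derivative) blast+
  then show "smooth_fun A V (\<lambda>q. coord_vec A c q a f)"
    by (rule smooth_fun_cong[rotated 2]) (use V in \<open>auto simp: coord_vec_def intro: smooth_nearI\<close>)
qed

text \<open>The extension has constant coefficients in a chart. It is only local, which avoids
  cut-off functions.\<close>

lemma obtain_smooth_extension:
  assumes "v \<in> tangent_space A p"
  obtains U X where "open U" "p \<in> U" "smooth_vf A U X" "X p = v"
proof -
  obtain c a where c: "c \<in> A" "p \<in> fst c" "v = coord_vec A c p a"
    using assms unfolding tangent_space_def by blast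
  then show ?thesis
    using that[of "fst c" "\<lambda>q. coord_vec A c q a"] smooth_vf_coord_vec open_chart_domain admissible_atlas
    by blast
qed

lemma lie_bracket_coord_vec:
  assumes c: "admissible A c" "p \<in> fst c"
  shows "lie_bracket A (\<lambda>q. coord_vec A c q a) (\<lambda>q. coord_vec A c q b) p = 0"
proof
  fix f
  show "lie_bracket A (\<lambda>q. coord_vec A c q a) (\<lambda>q. coord_vec A c q b) p f = 0 f"
  proof (cases "smooth_near A p f")
    case True
    then obtain U where U: "open U" "p \<in> U" "smooth_fun A U f"
      unfolding smooth_near_def by blast
    define V where "V = U \<inter> fst c"
    define F where "F = f \<circ> chart_inv c"
    note c_chart = admissible_is_chart[OF c(1)]
    have V: "open V" "p \<in> V" "V \<subseteq> fst c" "smooth_fun A V f"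
      using U c open_Int[OF U(1) open_chart_domain[OF c(1)]] smooth_fun_subset[OF U(3)] by (auto simp: V_def)
    have S: "open (snd c ` V)" "smooth_on (snd c ` V) F"
      using open_chart_image[OF c_chart U(1)] smooth_fun_in_chart[OF U(3,1) c(1)]
      by (auto simp: V_def F_def)
    \<comment> \<open>The inner function is a partial derivative of \<open>F\<close> only on the
      image of \<open>V\<close>; this is an open set around the point, which is enough for the outer
      derivative.\<close>
    have twice: "coord_vec A c p w (\<lambda>q. coord_vec A c q u f) =
        frechet_derivative (\<lambda>y. frechet_derivative F (at y) u) (at (snd c p)) w" for u w
    proof -
      have eq: "frechet_derivative F (at y) u = ((\<lambda>q. coord_vec A c q u f) \<circ> chart_inv c) y"
        if y: "y \<in> snd c ` V" for y
      proof -
        obtain q where q: "q \<in> V" "y = snd c q"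
          using y by blast
        have "smooth_near A q f"
          using V q by (auto intro: smooth_nearI)
        then show ?thesis
          using q V(3) chart_inv_left[OF c_chart, of q] by (auto simp: coord_vec_def F_def)
      qed
      have "smooth_fun A V (\<lambda>q. coord_vec A c q u f)"
        using smooth_vf_coord_vec[OF c(1)] V unfolding smooth_vf_def by blast
      then have "smooth_near A p (\<lambda>q. coord_vec A c q u f)"
        using V smooth_nearI by blast
      then have "coord_vec A c p w (\<lambda>q. coord_vec A c q u f) =
          frechet_derivative ((\<lambda>q. coord_vec A c q u f) \<circ> chart_inv c) (at (snd c p)) w"
        unfolding coord_vec_def[of A c p w] by simp
      also have "frechet_derivative ((\<lambda>q. coord_vec A c q u f) \<circ> chart_inv c) (at (snd c p)) =
          frechet_derivative (\<lambda>y. frechet_derivative F (at y) u) (at (snd c p))"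
        using V smooth_on_differentiable[OF smooth_on_frechet_derivative[OF S(2)]]
        by (intro frechet_derivative_transform_within_open[OF _ S(1) _ eq, symmetric]) auto
      finally show ?thesis .
    qed
    show ?thesis
      using smooth_on_second_derivative_symmetric[OF S, of "snd c p" a b] V True
      by (simp add: lie_bracket_def twice)
  qed (simp add: lie_bracket_def)
qed

end

section \<open>Almost Hermitian manifolds and the Levi-Civita connection\<close>

locale almost_hermitian_manifold = smooth_manifold A
  for A :: "'m::topological_space chart set" +
  fixes g :: "'m \<Rightarrow> 'm tvec \<Rightarrow> 'm tvec \<Rightarrow> real" and J :: "'m \<Rightarrow> 'm tvec \<Rightarrow> 'm tvec"
  assumes almost_hermitian: "almost_hermitian A g J"
begin

abbreviation T :: "'m \<Rightarrow> 'm tvec set" where "T \<equiv> tangent_space A"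

lemmas T_add = subspace_add[OF subspace_tangent_space]
  and T_scale = subspace_scale[OF subspace_tangent_space]
  and T_neg = subspace_neg[OF subspace_tangent_space]
  and T_diff = subspace_diff[OF subspace_tangent_space]
  and T_0 = subspace_0[OF subspace_tangent_space]

lemma metric: "riemannian_metric A g" and endo: "endo_field A J"
  using almost_hermitian unfolding almost_hermitian_def by blast+

lemma metric_lin:
  assumes "v \<in> T p"
  shows "lin_on (T p) (g p v)" "lin_on (T p) (\<lambda>w. g p w v)"
proof -
  have "\<forall>p. \<forall>v\<in>T p. lin_on (T p) (g p v) \<and> lin_on (T p) (\<lambda>w. g p w v)"
    using metric unfolding riemannian_metric_def bilinear_field_def by (elim conjE)
  with assms show "lin_on (T p) (g p v)" "lin_on (T p) (\<lambda>w. g p w v)"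
    by simp_all
qed

lemma metric_add_right: "\<lbrakk>u \<in> T p; v \<in> T p; w \<in> T p\<rbrakk> \<Longrightarrow> g p u (v + w) = g p u v + g p u w"
  using metric_lin(1)[of u p] unfolding lin_on_def by blast

lemma metric_add_left: "\<lbrakk>u \<in> T p; v \<in> T p; w \<in> T p\<rbrakk> \<Longrightarrow> g p (v + w) u = g p v u + g p w u"
  using metric_lin(2)[of u p] unfolding lin_on_def by blast

lemma metric_scale_right: "\<lbrakk>u \<in> T p; v \<in> T p\<rbrakk> \<Longrightarrow> g p u (r *\<^sub>R v) = r * g p u v"
  using metric_lin(1)[of u p] unfolding lin_on_def real_scaleR_def by blast

lemma metric_scale_left: "\<lbrakk>u \<in> T p; v \<in> T p\<rbrakk> \<Longrightarrow> g p (r *\<^sub>R v) u = r * g p v u"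
  using metric_lin(2)[of u p] unfolding lin_on_def real_scaleR_def by blast

lemma metric_minus_right: "\<lbrakk>u \<in> T p; v \<in> T p\<rbrakk> \<Longrightarrow> g p u (- v) = - g p u v"
  and metric_minus_left: "\<lbrakk>u \<in> T p; v \<in> T p\<rbrakk> \<Longrightarrow> g p (- v) u = - g p v u"
  using metric_scale_right[of u p v "-1"] metric_scale_left[of u p v "-1"] by simp_all

lemma metric_diff_right: "\<lbrakk>u \<in> T p; v \<in> T p; w \<in> T p\<rbrakk> \<Longrightarrow> g p u (v - w) = g p u v - g p u w"
  and metric_diff_left: "\<lbrakk>u \<in> T p; v \<in> T p; w \<in> T p\<rbrakk> \<Longrightarrow> g p (v - w) u = g p v u - g p w u"
  using metric_add_right[of u p v "- w"] metric_add_left[of u p v "- w"]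
  by (simp_all add: metric_minus_right metric_minus_left T_neg)

lemma metric_0_right: "u \<in> T p \<Longrightarrow> g p u 0 = 0"
  and metric_0_left: "u \<in> T p \<Longrightarrow> g p 0 u = 0"
  using metric_scale_right[of u p 0 0] metric_scale_left[of u p 0 0] T_0 by simp_all

lemmas metric_simps = metric_add_right metric_scale_right metric_add_left metric_scale_left
  metric_minus_right metric_minus_left metric_diff_right metric_diff_left metric_0_right metric_0_left

lemma metric_sym: "u \<in> T p \<Longrightarrow> v \<in> T p \<Longrightarrow> g p u v = g p v u"
  using metric unfolding riemannian_metric_def by blast

lemma metric_pos: "u \<in> T p \<Longrightarrow> u \<noteq> 0 \<Longrightarrow> g p u u > 0"
  using metric unfolding riemannian_metric_def by blast

lemma metric_eq_0: "u \<in> T p \<Longrightarrow> g p u u = 0 \<Longrightarrow> u = 0"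
  using metric_pos by force

lemma metric_eqI:
  assumes "u \<in> T p" "v \<in> T p" "\<And>w. w \<in> T p \<Longrightarrow> g p u w = g p v w"
  shows "u = v"
proof -
  have "g p (u - v) (u - v) = 0"
    using assms by (simp add: metric_simps T_diff)
  then show ?thesis
    using metric_eq_0[of "u - v" p] assms T_diff by simp
qed

lemma metric_smooth:
  "open U \<Longrightarrow> smooth_vf A U X \<Longrightarrow> smooth_vf A U Y \<Longrightarrow> smooth_fun A U (\<lambda>q. g q (X q) (Y q))"
  using metric unfolding riemannian_metric_def bilinear_field_def by simp

lemma J_closed: "u \<in> T p \<Longrightarrow> J p u \<in> T p"
  and J_add: "u \<in> T p \<Longrightarrow> v \<in> T p \<Longrightarrow> J p (u + v) = J p u + J p v"
  and J_scale: "u \<in> T p \<Longrightarrow> J p (r *\<^sub>R u) = r *\<^sub>R J p u"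
  using endo unfolding endo_field_def lin_on_def by (simp_all add: image_subset_iff)

lemma J_minus: "u \<in> T p \<Longrightarrow> J p (- u) = - J p u"
  using J_scale[of u p "-1"] by simp

lemma J_0: "J p 0 = 0"
  using J_scale[of 0 p 0] T_0 by simp

lemma J_diff: "u \<in> T p \<Longrightarrow> v \<in> T p \<Longrightarrow> J p (u - v) = J p u - J p v"
  using J_add[of u p "- v"] by (simp add: J_minus T_neg)

lemma J_J: "u \<in> T p \<Longrightarrow> J p (J p u) = - u"
  using almost_hermitian unfolding almost_hermitian_def by blast

lemma J_smooth: "open U \<Longrightarrow> smooth_vf A U X \<Longrightarrow> smooth_vf A U (\<lambda>q. J q (X q))"
  using endo unfolding endo_field_def by blast

lemma metric_J_J: "u \<in> T p \<Longrightarrow> v \<in> T p \<Longrightarrow> g p (J p u) (J p v) = g p u v"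
  using almost_hermitian unfolding almost_hermitian_def by blast

lemma metric_J_left: "u \<in> T p \<Longrightarrow> v \<in> T p \<Longrightarrow> g p (J p u) v = - g p u (J p v)"
  using metric_J_J[of u p "J p v"] by (simp add: J_closed J_J metric_simps)

lemma metric_J_self: "u \<in> T p \<Longrightarrow> g p u (J p u) = 0"
  using metric_J_left[of u p u] metric_sym[of "J p u" p u] J_closed by simp

lemma J_eq_0: "u \<in> T p \<Longrightarrow> J p u = 0 \<Longrightarrow> u = 0"
  using J_J[of u p] J_0 by simp

end

locale levi_civita_manifold = almost_hermitian_manifold +
  fixes nabla :: "'a connection"
  assumes levi_civita: "levi_civita A g nabla"
begin

lemma nabla_lin:
  assumes "open U" "p \<in> U" "smooth_vf A U Y"
  shows "lin_on (T p) (nabla Y p)" "nabla Y p ` T p \<subseteq> T p"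
proof -
  have "affine_connection A nabla"
    using levi_civita unfolding levi_civita_def by (rule conjunct1)
  then have "\<forall>Y p. smooth_vf A U Y \<and> p \<in> U \<longrightarrow>
      lin_on (T p) (nabla Y p) \<and> nabla Y p ` T p \<subseteq> T p"
    unfolding affine_connection_def using assms(1) by (elim allE[of _ U] impE conjE)
  with assms show "lin_on (T p) (nabla Y p)" "nabla Y p ` T p \<subseteq> T p"
    by simp_all
qed

lemma nabla_closed:
  assumes "open U" "p \<in> U" "smooth_vf A U Y" "v \<in> T p"
  shows "nabla Y p v \<in> T p"
  using nabla_lin(2)[OF assms(1-3)] assms(4) by blast

lemma nabla_minus:
  assumes "open U" "p \<in> U" "smooth_vf A U Y" "v \<in> T p"
  shows "nabla Y p (- v) = - nabla Y p v"
proof -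
  have "nabla Y p ((-1) *\<^sub>R v) = (-1) *\<^sub>R nabla Y p v"
    using nabla_lin(1)[OF assms(1-3)] assms(4) unfolding lin_on_def by blast
  then show ?thesis by simp
qed

lemma levi_civita_at:
  assumes "open U" "p \<in> U" "smooth_vf A U X" "smooth_vf A U Y"
  shows "nabla Y p (X p) - nabla X p (Y p) = lie_bracket A X Y p \<and>
    (\<forall>v\<in>T p. v (\<lambda>q. g q (X q) (Y q)) = g p (nabla X p v) (Y p) + g p (X p) (nabla Y p v))"
  using conjunct2[OF levi_civita[unfolded levi_civita_def], THEN spec[of _ U], THEN spec[of _ X],
      THEN spec[of _ Y], THEN spec[of _ p]] assms
  by (elim impE) (intro conjI)

lemma torsion_free:
  assumes "open U" "p \<in> U" "smooth_vf A U X" "smooth_vf A U Y"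
  shows "lie_bracket A X Y p = nabla Y p (X p) - nabla X p (Y p)"
  by (rule conjunct1[OF levi_civita_at[OF assms], symmetric])

lemma metric_compatible:
  assumes "open U" "p \<in> U" "smooth_vf A U X" "smooth_vf A U Y" "v \<in> T p"
  shows "v (\<lambda>q. g q (X q) (Y q)) = g p (nabla X p v) (Y p) + g p (X p) (nabla Y p v)"
  by (rule bspec[OF conjunct2[OF levi_civita_at[OF assms(1-4)]] assms(5)])

lemma lie_bracket_closed:
  assumes "open U" "p \<in> U" "smooth_vf A U X" "smooth_vf A U Y"
  shows "lie_bracket A X Y p \<in> T p"
  unfolding torsion_free[OF assms]
  by (intro T_diff nabla_closed[OF assms(1,2)] assms smooth_vf_tangent[of A U])

end

section \<open>The complex structure of a Kaehler surface is parallel\<close>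

lemma std_J_std_J: "std_J (std_J a) = - a"
  by (simp add: std_J_def vec_eq_iff forall_4 vector_def)

lemma std_J_minus: "std_J (- a) = - std_J a"
  by (simp add: std_J_def vec_eq_iff forall_4 vector_def)

text \<open>For commuting coordinate fields, \<open>G a b c\<close> stands for \<open>g(\<nabla>\<^sub>a X\<^sub>b, X\<^sub>c)\<close> and \<open>s\<close> for the
  complex structure, so \<open>N a b c\<close> below is \<open>g((\<nabla>\<^sub>a J) X\<^sub>b, X\<^sub>c)\<close>.\<close>

lemma kaehler_christoffel_identity:
  fixes G :: "'v::group_add \<Rightarrow> 'v \<Rightarrow> 'v \<Rightarrow> real" and s :: "'v \<Rightarrow> 'v"
  assumes ss: "\<And>a. s (s a) = - a" and s_minus: "\<And>a. s (- a) = - s a"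
    and sym: "\<And>a b c. G a b c = G b a c"
    and minus1: "\<And>a b c. G (- a) b c = - G a b c" and minus3: "\<And>a b c. G a b (- c) = - G a b c"
    and skew: "\<And>a b c. G a (s b) c + G a c (s b) = - (G a b (s c) + G a (s c) b)"
    and closed: "\<And>a b c. (G a (s b) c + G a c (s b)) + (G b (s c) a + G b a (s c))
      + (G c (s a) b + G c b (s a)) = 0"
  shows "G a (s b) c + G a b (s c) = 0"
proof -
  define N where "N = (\<lambda>a b c. G a (s b) c + G a b (s c))"
  \<comment> \<open>Derivative of the skew-adjointness of \<open>J\<close>.\<close>
  have N_skew: "N a b c = - N a c b" for a b c
    using skew[of a b c] by (simp add: N_def)
  \<comment> \<open>Derivative of \<open>J J = -1\<close>: the endomorphism
    \<open>\<nabla>\<^sub>a J\<close> anticommutes with \<open>J\<close>, and moving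
    \<open>J\<close> across \<open>g\<close> changes the sign again.\<close>
  have N_s: "N a (s b) c = N a b (s c)" for a b c
    using minus1[of b a c] sym[of a "- b" c] sym[of b a c] minus3[of a b c] by (simp add: N_def ss)
  \<comment> \<open>\<open>S = 0\<close> says that \<open>\<nabla> J\<close> along
    \<open>J X\<close> equals \<open>J\<close> composed with \<open>\<nabla> J\<close> along
    \<open>X\<close>. The symmetry of \<open>S\<close> in its first two arguments is where
    integrability enters: it rests on torsion-freeness for commuting fields that \<open>J\<close>
    permutes.\<close>
  define S where "S = (\<lambda>a b c. N (s a) b c + N a b (s c))"
  have S_sym: "S a b c = S b a c" for a b c
    using sym[of "s a" "s b" c] sym[of "s a" b "s c"] sym[of "s b" a "s c"] sym[of a b "s (s c)"]
    by (simp add: S_def N_def)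
  have S_skew: "S a b c = - S a c b" for a b c
    using N_skew[of "s a" b c] N_skew[of a b "s c"] N_s[of a c b] by (simp add: S_def)
  \<comment> \<open>A form symmetric in the first two and skew in the last two arguments vanishes:
    six alternating exchanges return to the same term with the opposite sign.\<close>
  have S_0: "S a b c = 0" for a b c
    using S_sym[of a b c] S_skew[of b a c] S_sym[of b c a] S_skew[of c b a] S_sym[of c a b] S_skew[of a c b]
    by linarith
  have N_s1: "N (s a) b c = - N a b (s c)" for a b c
    using S_0[of a b c] by (simp add: S_def)
  \<comment> \<open>This is \<open>d\<omega> = 0\<close> written in terms of
    \<open>\<nabla> J\<close>.\<close>
  have cyclic: "N a b c + N b c a + N c a b = 0" for a b c
    using closed[of a b c] sym[of a c "s b"] sym[of b a "s c"] sym[of c b "s a"] by (simp add: N_def)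
  \<comment> \<open>Putting \<open>s c\<close> for \<open>c\<close> in the cyclic identity makes one
    of its three terms change sign. The sum of this relation and a cyclic permutation of it leaves a
    single term twice.\<close>
  have U: "N a b (s c) + N b c (s a) - N c a (s b) = 0" for a b c
    using cyclic[of a b "s c"] N_s[of b c a] N_s1[of c a b] by simp
  have "N a b (s c) = 0" for a b c
    using U[of c a b] U[of a b c] by linarith
  from this[of a b "- s c"] show ?thesis
    by (simp add: N_def s_minus ss)
qed

locale kaehler_manifold = levi_civita_manifold +
  assumes integrable: "integrable_complex A J"
    and closed: "closed_2form A (kaehler_form g J)"
begin

text \<open>In a holomorphic chart \<open>J\<close> acts on the constant coefficients through
  \<open>std_J\<close>. Hence \<open>\<nabla> J\<close> involves only the numbers \<open>G\<close>,
  and their symmetry in the first two arguments is torsion-freeness for commuting fields.\<close>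

lemma nabla_J_coord_vec:
  assumes c: "admissible A c" "p \<in> fst c"
    and hol: "\<And>q a. q \<in> fst c \<Longrightarrow> J q (coord_vec A c q a) = coord_vec A c q (std_J a)"
    and v: "v \<in> T p"
  shows "nabla (\<lambda>q. coord_vec A c q (std_J b)) p v = J p (nabla (\<lambda>q. coord_vec A c q b) p v)"
proof -
  define X where "X = (\<lambda>a q. coord_vec A c q a)"
  define G where "G = (\<lambda>a b c. g p (nabla (X b) p (X a p)) (X c p))"
  note U = open_chart_domain[OF c(1)]
  have X: "smooth_vf A (fst c) (X a)" for a
    unfolding X_def by (rule smooth_vf_coord_vec[OF c(1)])
  have XT: "q \<in> fst c \<Longrightarrow> X a q \<in> T q" for a q
    by (rule smooth_vf_tangent[OF X])
  have X_minus: "X (- a) p = - X a p" for a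
    unfolding X_def by (rule linear_neg[OF coord_vec_linear[OF c]])
  have JX: "q \<in> fst c \<Longrightarrow> J q (X a q) = X (std_J a) q" for a q
    unfolding X_def by (rule hol)
  have nT: "nabla (X b) p (X a p) \<in> T p" for a b
    by (rule nabla_closed[OF U c(2) X XT[OF c(2)]])
  have bracket: "lie_bracket A (X a) (X b) p = 0" for a b
    unfolding X_def by (rule lie_bracket_coord_vec[OF c])
  then have nabla_sym: "nabla (X b) p (X a p) = nabla (X a) p (X b p)" for a b
    using torsion_free[OF U c(2) X X, of a b] by simp
  have M: "X a p (\<lambda>q. g q (X b q) (X c q)) = G a b c + G a c b" for a b c
    using metric_compatible[OF U c(2) X X XT[OF c(2)], of a b c]
      metric_sym[OF XT[OF c(2)] nT] by (simp add: G_def)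
  have near: "smooth_near A p (\<lambda>q. g q (X b q) (X c q))" for b c
    using metric_smooth[OF U X X] smooth_nearI[OF U c(2)] by blast
  have M_skew: "X a p (\<lambda>q. g q (X (std_J b) q) (X c q)) = - X a p (\<lambda>q. g q (X b q) (X (std_J c) q))" for a b c
  proof -
    have "X a p (\<lambda>q. g q (X (std_J b) q) (X c q)) = X a p (\<lambda>q. (-1) * g q (X b q) (X (std_J c) q))"
      by (rule tangent_vector_cong[OF XT[OF c(2)] U c(2)]) (simp add: JX[symmetric] metric_J_left XT)
    then show ?thesis
      using tangent_vector_scale[OF XT[OF c(2)] near, of a "-1" b "std_J c"] by simp
  qed
  have M_omega: "X a p (\<lambda>q. kaehler_form g J q (X b q) (X c q)) = X a p (\<lambda>q. g q (X (std_J b) q) (X c q))" for a b c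
    by (rule tangent_vector_cong[OF XT[OF c(2)] U c(2)]) (simp add: kaehler_form_def JX)
  have "G a (std_J b) d + G a b (std_J d) = 0" for a b d
  proof (rule kaehler_christoffel_identity[where s = std_J and G = G])
    show "G a b c = G b a c" for a b c
      by (simp add: G_def nabla_sym[of b a])
    show "G (- a) b c = - G a b c" for a b c
      using nabla_minus[OF U c(2) X XT[OF c(2)]] nT XT[OF c(2)]
      by (simp add: G_def X_minus metric_simps)
    show "G a b (- c) = - G a b c" for a b c
      using nT XT[OF c(2)] by (simp add: G_def X_minus metric_simps)
    show "G a (std_J b) c + G a c (std_J b) = - (G a b (std_J c) + G a (std_J c) b)" for a b c
      using M_skew[of a b c] by (simp add: M)
    show "(G a (std_J b) d + G a d (std_J b)) + (G b (std_J d) a + G b a (std_J d))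
        + (G d (std_J a) b + G d b (std_J a)) = 0" for a b d
    proof -
      have "ext_deriv2 A (kaehler_form g J) (X a) (X b) (X d) p = 0"
        using closed U X c(2) unfolding closed_2form_def by blast
      \<comment> \<open>All three bracket terms are gone, so only derivatives of metric coefficients
        remain. Skew-adjointness of \<open>J\<close> turns the minus sign of the middle term into
        the plus sign of the cyclic sum.\<close>
      then have "X a p (\<lambda>q. g q (X (std_J b) q) (X d q)) - X b p (\<lambda>q. g q (X (std_J a) q) (X d q))
          + X d p (\<lambda>q. g q (X (std_J a) q) (X b q)) = 0"
        by (simp add: ext_deriv2_def M_omega bracket)
           (simp add: kaehler_form_def J_0 metric_0_left XT[OF c(2)])
      then show ?thesis
        using M_skew[of b a d] by (simp add: M)
    qed
  qed (auto simp: std_J_std_J std_J_minus)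
  then have "nabla (X (std_J b)) p (X a p) = J p (nabla (X b) p (X a p))" for a
  proof (intro metric_eqI[of _ p])
    fix w assume "w \<in> T p" and 0: "\<And>a b d. G a (std_J b) d + G a b (std_J d) = 0"
    then obtain d where d: "w = X d p"
      using tangent_space_chart[OF c] unfolding X_def by blast
    have "g p (nabla (X b) p (X a p)) (X (std_J d) p) = - g p (J p (nabla (X b) p (X a p))) w"
      using metric_J_left[OF nT, of w b a] XT[OF c(2)] JX[OF c(2)] by (simp add: d)
    then show "g p (nabla (X (std_J b)) p (X a p)) w = g p (J p (nabla (X b) p (X a p))) w"
      using 0[of a b d] by (simp add: G_def d)
  qed (auto intro: nT J_closed)
  moreover obtain a where "v = X a p"
    using v tangent_space_chart[OF c] unfolding X_def by blast
  ultimately show ?thesis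
    by (simp add: X_def)
qed

text \<open>Pairing \<open>J Y\<close> with a coordinate field moves \<open>J\<close> onto that
  field, where it is already known to be parallel. Differentiating the pairing by metric
  compatibility then settles a general \<open>Y\<close> without expanding it in coordinates.\<close>

lemma nabla_J:
  assumes U: "open U" "p \<in> U" and Y: "smooth_vf A U Y" and v: "v \<in> T p"
  shows "nabla (\<lambda>q. J q (Y q)) p v = J p (nabla Y p v)"
proof -
  obtain c where c: "admissible A c" "p \<in> fst c"
    and hol: "\<And>q a. q \<in> fst c \<Longrightarrow> J q (coord_vec A c q a) = coord_vec A c q (std_J a)"
    using integrable unfolding integrable_complex_def by metis
  define X where "X = (\<lambda>a q. coord_vec A c q a)"
  define V where "V = U \<inter> fst c"
  have V: "open V" "p \<in> V"
    using U c open_Int[OF U(1) open_chart_domain[OF c(1)]] by (auto simp: V_def)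
  have X: "smooth_vf A V (X a)" for a
    unfolding X_def by (rule smooth_vf_subset[OF smooth_vf_coord_vec[OF c(1)]]) (simp add: V_def)
  have YV: "smooth_vf A V Y"
    by (rule smooth_vf_subset[OF Y]) (simp add: V_def)
  have JYV: "smooth_vf A V (\<lambda>q. J q (Y q))"
    by (rule J_smooth[OF V(1) YV])
  note tan = smooth_vf_tangent[OF X] smooth_vf_tangent[OF YV]
  have nT: "nabla Y p v \<in> T p" "nabla (\<lambda>q. J q (Y q)) p v \<in> T p" "nabla (X a) p v \<in> T p" for a
    using nabla_closed[OF V YV v] nabla_closed[OF V JYV v] nabla_closed[OF V X v] by auto
  show ?thesis
  proof (rule metric_eqI[OF nT(2) J_closed[OF nT(1)]])
    fix w assume "w \<in> T p"
    then obtain a where w: "w = X a p"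
      using tangent_space_chart[OF c] unfolding X_def by blast
    have XJ: "X (std_J a) q = J q (X a q)" if "q \<in> V" for q
      using hol that by (simp add: X_def V_def)
    have "v (\<lambda>q. g q (J q (Y q)) (X a q)) = v (\<lambda>q. (-1) * g q (Y q) (X (std_J a) q))"
      by (rule tangent_vector_cong[OF v V]) (simp add: XJ metric_J_left tan)
    also have "\<dots> = - v (\<lambda>q. g q (Y q) (X (std_J a) q))"
      using tangent_vector_scale[OF v, of "\<lambda>q. g q (Y q) (X (std_J a) q)" "-1"]
        smooth_nearI[OF V metric_smooth[OF V(1) YV X]] by simp
    finally have "g p (nabla (\<lambda>q. J q (Y q)) p v) w + g p (J p (Y p)) (nabla (X a) p v) =
        - (g p (nabla Y p v) (J p w) + g p (Y p) (nabla (X (std_J a)) p v))"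
      using metric_compatible[OF V YV X v, of "std_J a"] metric_compatible[OF V JYV X v, of a]
      by (simp add: w XJ[OF V(2)])
    moreover have "nabla (X (std_J a)) p v = J p (nabla (X a) p v)"
      using nabla_J_coord_vec[OF c hol v] by (simp add: X_def)
    ultimately show "g p (nabla (\<lambda>q. J q (Y q)) p v) w = g p (J p (nabla Y p v)) w"
      using metric_J_left[OF nT(1) \<open>w \<in> T p\<close>] metric_J_left[OF tan(2)[OF V(2)] nT(3)] by simp
  qed
qed

end

section \<open>Orthogonal complements of complex lines\<close>

context almost_hermitian_manifold
begin

lemma orthogonal_independent:
  assumes S: "finite S" "S \<subseteq> T p" "0 \<notin> S"
    and orth: "\<And>u v. u \<in> S \<Longrightarrow> v \<in> S \<Longrightarrow> u \<noteq> v \<Longrightarrow> g p u v = 0"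
  shows "independent S"
proof
  assume "dependent S"
  then obtain r v where v: "v \<in> S" "r v \<noteq> 0" and sum: "(\<Sum>w\<in>S. r w *\<^sub>R w) = 0"
    using real_vector.dependent_finite[OF S(1)] by blast
  have vT: "v \<in> T p"
    using v S by blast
  \<comment> \<open>Bilinearity of \<open>g p\<close> holds only on \<open>T p\<close>, so the
    induction carries along that the partial sums are tangent.\<close>
  have "(\<Sum>w\<in>R. r w *\<^sub>R w) \<in> T p \<and> g p (\<Sum>w\<in>R. r w *\<^sub>R w) v = (\<Sum>w\<in>R. r w * g p w v)"
    if "finite R" "R \<subseteq> S" for R
    using that
  proof (induction R rule: finite_induct)
    case empty
    then show ?case
      unfolding sum.empty using metric_0_left[OF vT] T_0 by blast
  next
    case (insert w R)
    then have w: "w \<in> T p" "r w *\<^sub>R w \<in> T p"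
      using S(2) T_scale by blast+
    have R: "(\<Sum>w\<in>R. r w *\<^sub>R w) \<in> T p" "g p (\<Sum>w\<in>R. r w *\<^sub>R w) v = (\<Sum>w\<in>R. r w * g p w v)"
      using insert by blast+
    show ?case
      unfolding sum.insert[OF insert.hyps(1,2)]
      using T_add[OF w(2) R(1)] metric_add_left[OF vT w(2) R(1)] metric_scale_left[OF vT w(1)] R(2) by metis
  qed
  then have "(\<Sum>w\<in>S. r w * g p w v) = g p 0 v"
    using S(1) sum by force
  moreover have "(\<Sum>w\<in>S. r w * g p w v) = (\<Sum>w\<in>S. if w = v then r v * g p v v else 0)"
    by (intro sum.cong) (use orth v(1) in auto)
  ultimately have "r v * g p v v = 0"
    using S(1) v(1) metric_0_left[OF vT] by (simp add: sum.delta)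
  then show False
    using v S vT metric_eq_0 by auto
qed

text \<open>Dimension bounds become bounds on the number of nonzero orthogonal vectors. The choice
  of \<open>W\<close> covers both the leaf directions and, with \<open>W = UNIV\<close>, the whole
  tangent space.\<close>

lemma orthogonal_card_le:
  assumes c: "admissible A c" "p \<in> fst c" and W: "subspace W"
    and S: "finite S" "S \<subseteq> coord_vec A c p ` W" "0 \<notin> S"
    and orth: "\<And>u v. u \<in> S \<Longrightarrow> v \<in> S \<Longrightarrow> u \<noteq> v \<Longrightarrow> g p u v = 0"
  shows "card S \<le> dim W"
proof -
  obtain B where B: "B \<subseteq> W" "independent B" "W \<subseteq> span B" "card B = dim W"
    using basis_exists by blast
  note L = coord_vec_linear[OF c]
  have "S \<subseteq> T p"
    using S(2) tangent_space_chart[OF c] by blast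
  then have "independent S"
    using orthogonal_independent[OF S(1) _ S(3) orth] by blast
  moreover have "S \<subseteq> span (coord_vec A c p ` B)"
    using S(2) B(3) by (auto simp: linear_span_image[OF L])
  ultimately have "card S \<le> card (coord_vec A c p ` B)"
    using real_vector.independent_span_bound independent_imp_finite[OF B(2)] by blast
  also have "\<dots> \<le> dim W"
    using B(2,4) card_image_le independent_imp_finite by metis
  finally show ?thesis .
qed

text \<open>\<open>u\<close> and \<open>J u\<close> are orthogonal and equally long, so both
  projection coefficients have the denominator \<open>g p u u\<close>.\<close>

lemma project_complex_line:
  assumes u: "u \<in> T p" "u \<noteq> 0" and v: "v \<in> T p"
  obtains a b z where "v = a *\<^sub>R u + b *\<^sub>R J p u + z" "z \<in> T p" "g p z u = 0" "g p z (J p u) = 0"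
proof -
  define a where "a = g p v u / g p u u"
  define b where "b = g p v (J p u) / g p u u"
  define z where "z = v - (a *\<^sub>R u + b *\<^sub>R J p u)"
  note T = T_add T_scale T_diff J_closed
  have uu: "g p u u \<noteq> 0"
    using metric_pos[OF u] by simp
  have Ju: "g p (J p u) (J p u) = g p u u" "g p u (J p u) = 0" "g p (J p u) u = 0"
    using metric_J_J metric_J_self metric_sym u(1) J_closed by metis+
  have "z \<in> T p"
    unfolding z_def using u v by (intro T)
  moreover have "g p z u = 0"
    unfolding z_def using u v Ju uu by (simp add: metric_simps T) (simp add: a_def)
  moreover have "g p z (J p u) = 0"
    unfolding z_def using u v Ju uu by (simp add: metric_simps T) (simp add: b_def)
  moreover have "v = a *\<^sub>R u + b *\<^sub>R J p u + z"
    by (simp add: z_def)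
  ultimately show ?thesis
    using that by blast
qed

lemma orthogonal_distinct:
  "u \<in> T p \<Longrightarrow> u \<noteq> 0 \<Longrightarrow> g p u v = 0 \<Longrightarrow> u \<noteq> v"
  using metric_pos by force

end

section \<open>Lie derivatives in terms of the connection\<close>

context levi_civita_manifold
begin

text \<open>The covariant derivatives along \<open>V\<close> from the metric term and from the
  brackets cancel. What is left depends only on the values of \<open>X\<close> and \<open>Y\<close>
  at \<open>p\<close>.\<close>

lemma lie_deriv_metric_eq:
  assumes U: "open U" "p \<in> U" and V: "smooth_vf A U V" and X: "smooth_vf A U X" and Y: "smooth_vf A U Y"
  shows "lie_deriv_metric A g V X Y p = g p (nabla V p (X p)) (Y p) + g p (X p) (nabla V p (Y p))"
proof -
  have tan: "V p \<in> T p" "X p \<in> T p" "Y p \<in> T p"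
    using V X Y U smooth_vf_tangent by blast+
  have "nabla X p (V p) \<in> T p" "nabla Y p (V p) \<in> T p" "nabla V p (X p) \<in> T p" "nabla V p (Y p) \<in> T p"
    using nabla_closed[OF U] V X Y tan by blast+
  then show ?thesis
    unfolding lie_deriv_metric_def torsion_free[OF U V X] torsion_free[OF U V Y]
      metric_compatible[OF U X Y tan(1)]
    using tan by (simp add: metric_diff_left metric_diff_right)
qed

end

context kaehler_manifold
begin

text \<open>Because \<open>J\<close> is parallel, the two terms containing the derivative of
  \<open>X\<close> along \<open>V\<close> cancel, so only the value of \<open>X\<close> at
  \<open>p\<close> matters.\<close>

lemma lie_deriv_J_eq:
  assumes U: "open U" "p \<in> U" and V: "smooth_vf A U V" and X: "smooth_vf A U X"
  shows "lie_deriv_endo A J V X p = J p (nabla V p (X p)) - nabla V p (J p (X p))"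
proof -
  have tan: "V p \<in> T p" "X p \<in> T p"
    using V X U smooth_vf_tangent by blast+
  have "nabla X p (V p) \<in> T p" "nabla V p (X p) \<in> T p"
    using nabla_closed[OF U] V X tan by blast+
  then show ?thesis
    unfolding lie_deriv_endo_def torsion_free[OF U V X] torsion_free[OF U V J_smooth[OF U(1) X]]
      nabla_J[OF U X tan(1)]
    by (simp add: J_diff)
qed

end

section \<open>Complex foliations of Kaehler surfaces\<close>

locale complex_foliation = kaehler_manifold +
  fixes D :: "'a \<Rightarrow> 'a tvec set" and I :: "'a \<Rightarrow> 'a tvec \<Rightarrow> 'a tvec" and \<theta> :: "'a \<Rightarrow> 'a tvec \<Rightarrow> real"
  assumes foliation: "foliation A 2 D"
    and complex_D: "complex_distribution J D"
    and hermitian_I: "almost_hermitian A g I"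
    and I_D: "\<And>p v. v \<in> D p \<Longrightarrow> I p v = J p v"
    and I_E: "\<And>p v. v \<in> orth_complement A g D p \<Longrightarrow> I p v = - J p v"
    and ext_deriv_I: "\<And>U X Y Z p. \<lbrakk>open U; p \<in> U; smooth_vf A U X; smooth_vf A U Y; smooth_vf A U Z\<rbrakk> \<Longrightarrow>
      ext_deriv2 A (kaehler_form g I) X Y Z p = 2 * wedge12 \<theta> (kaehler_form g I) p (X p) (Y p) (Z p)"
begin

sublocale H: almost_hermitian_manifold A g I
  by unfold_locales (rule hermitian_I)

section \<open>The orthogonal splitting of the tangent spaces into two complex lines\<close>

abbreviation E :: "'a \<Rightarrow> 'a tvec set" where "E \<equiv> orth_complement A g D"

lemma obtain_foliation_chart:
  obtains c W where "admissible A c" "p \<in> fst c" "subspace W" "dim W = 2"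
    "\<And>q. q \<in> fst c \<Longrightarrow> D q = coord_vec A c q ` W"
  using foliation unfolding foliation_def by metis

lemma subspace_D: "subspace (D p)"
  using obtain_foliation_chart[of p] linear_subspace_image[OF coord_vec_linear] by metis

lemma D_tangent: "v \<in> D p \<Longrightarrow> v \<in> T p"
proof -
  obtain c W where "admissible A c" "p \<in> fst c" "D p = coord_vec A c p ` W"
    using obtain_foliation_chart[of p] by metis
  then show "v \<in> D p \<Longrightarrow> v \<in> T p"
    using tangent_space_chart by blast
qed

lemma E_tangent: "v \<in> E p \<Longrightarrow> v \<in> T p"
  unfolding orth_complement_def by blast

lemma D_E_orth: "u \<in> D p \<Longrightarrow> x \<in> E p \<Longrightarrow> g p u x = 0"
  and E_D_orth: "u \<in> D p \<Longrightarrow> x \<in> E p \<Longrightarrow> g p x u = 0"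
proof -
  assume "u \<in> D p" "x \<in> E p"
  then show "g p x u = 0"
    unfolding orth_complement_def by blast
  then show "g p u x = 0"
    using metric_sym D_tangent E_tangent \<open>u \<in> D p\<close> \<open>x \<in> E p\<close> by metis
qed

lemma J_D: "v \<in> D p \<Longrightarrow> J p v \<in> D p"
  using complex_D unfolding complex_distribution_def by blast

lemma J_E: "x \<in> E p \<Longrightarrow> J p x \<in> E p"
proof -
  assume x: "x \<in> E p"
  have "g p (J p x) w = 0" if "w \<in> D p" for w
    using metric_J_left[OF E_tangent[OF x] D_tangent[OF that]] E_D_orth[OF J_D[OF that] x] by simp
  then show "J p x \<in> E p"
    using J_closed[OF E_tangent[OF x]] unfolding orth_complement_def by simp
qed

lemma obtain_D_nonzero:
  obtains u where "u \<in> D p" "u \<noteq> 0"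
proof -
  obtain c W where c: "admissible A c" "p \<in> fst c" and W: "dim W = 2" "D p = coord_vec A c p ` W"
    using obtain_foliation_chart[of p] by metis
  have "\<not> W \<subseteq> {0}"
    using W(1) dim_eq_0[of W] by auto
  then show ?thesis
    using that coord_vec_eq_0_iff[OF c] W(2) by blast
qed

text \<open>A nonzero remainder \<open>z\<close> of \<open>v\<close> would make \<open>u\<close>,
  \<open>J u\<close>, \<open>z\<close> three orthogonal nonzero vectors in the image of a
  plane.\<close>

lemma D_span:
  assumes u: "u \<in> D p" "u \<noteq> 0" and v: "v \<in> D p"
  obtains a b where "v = a *\<^sub>R u + b *\<^sub>R J p u"
proof -
  obtain c W where c: "admissible A c" "p \<in> fst c" and W: "subspace W" "dim W = 2" "D p = coord_vec A c p ` W"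
    using obtain_foliation_chart[of p] by metis
  note uT = D_tangent[OF u(1)]
  obtain a b z where z: "v = a *\<^sub>R u + b *\<^sub>R J p u + z" "z \<in> T p" "g p z u = 0" "g p z (J p u) = 0"
    using project_complex_line[OF uT u(2) D_tangent[OF v]] by blast
  have "z = v - (a *\<^sub>R u + b *\<^sub>R J p u)"
    using z(1) by simp
  then have zD: "z \<in> D p"
    using u v J_D subspace_D by (simp add: subspace_add subspace_scale subspace_diff)
  have "z = 0"
  proof (rule ccontr)
    assume z0: "z \<noteq> 0"
    have JuT: "J p u \<in> T p" "J p u \<noteq> 0"
      using J_closed[OF uT] J_eq_0[OF uT] u(2) by auto
    have orth: "g p u (J p u) = 0" "g p (J p u) u = 0" "g p u z = 0" "g p (J p u) z = 0"
      using metric_J_self[OF uT] metric_sym[OF uT JuT(1)] metric_sym[OF uT z(2)] metric_sym[OF JuT(1) z(2)] z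
      by auto
    have "card {u, J p u, z} \<le> dim W"
    proof (rule orthogonal_card_le[OF c W(1)])
      show "{u, J p u, z} \<subseteq> coord_vec A c p ` W"
        unfolding W(3)[symmetric] using u(1) J_D zD by simp
    qed (use u z0 JuT orth z in auto)
    moreover have "u \<noteq> J p u" "u \<noteq> z" "J p u \<noteq> z"
      using orthogonal_distinct[OF uT u(2)] orthogonal_distinct[OF JuT] orth by auto
    then have "card {u, J p u, z} = 3" by simp
    ultimately show False
      using W(2) by simp
  qed
  then show ?thesis
    using that z(1) by simp
qed

text \<open>With a nonzero remainder \<open>z\<close>, the vectors \<open>u\<close>,
  \<open>J u\<close> in \<open>D\<close> and \<open>x\<close>, \<open>J x\<close>, \<open>z\<close>
  orthogonal to them would be five orthogonal nonzero vectors in a four-dimensional tangent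
  space.\<close>

lemma E_span:
  assumes x: "x \<in> E p" "x \<noteq> 0" and y: "y \<in> E p"
  obtains a b where "y = a *\<^sub>R x + b *\<^sub>R J p x"
proof -
  obtain u where u: "u \<in> D p" "u \<noteq> 0"
    by (rule obtain_D_nonzero)
  obtain c where c: "admissible A c" "p \<in> fst c"
    using obtain_foliation_chart[of p] by metis
  note T = D_tangent[OF u(1)] E_tangent[OF x(1)] E_tangent[OF y]
  obtain a b z where z: "y = a *\<^sub>R x + b *\<^sub>R J p x + z" "z \<in> T p" "g p z x = 0" "g p z (J p x) = 0"
    using project_complex_line[OF T(2) x(2) T(3)] by blast
  have "z = y - (a *\<^sub>R x + b *\<^sub>R J p x)"
    using z(1) by simp
  then have zD: "g p z d = 0" "g p d z = 0" if "d \<in> D p" for d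
  proof -
    show "g p z d = 0"
      using E_D_orth[OF that x(1)] E_D_orth[OF that y] E_D_orth[OF that J_E[OF x(1)]]
        T D_tangent[OF that] J_closed \<open>z = y - (a *\<^sub>R x + b *\<^sub>R J p x)\<close>
      by (simp add: metric_simps T_add T_scale)
    then show "g p d z = 0"
      using metric_sym[OF D_tangent[OF that] z(2)] by simp
  qed
  have "z = 0"
  proof (rule ccontr)
    assume z0: "z \<noteq> 0"
    have J: "J p u \<in> T p" "J p u \<noteq> 0" "J p x \<in> T p" "J p x \<noteq> 0"
      using J_closed T J_eq_0[OF T(1)] J_eq_0[OF T(2)] u(2) x(2) by auto
    have 1: "g p u (J p u) = 0" "g p (J p u) u = 0" "g p x (J p x) = 0" "g p (J p x) x = 0"
      "g p x z = 0" "g p (J p x) z = 0"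
      using metric_J_self[OF T(1)] metric_J_self[OF T(2)] metric_sym[OF J(1) T(1)] metric_sym[OF J(3) T(2)]
        metric_sym[OF T(2) z(2)] metric_sym[OF J(3) z(2)] z by auto
    have 2: "g p u x = 0" "g p u (J p x) = 0" "g p (J p u) x = 0" "g p (J p u) (J p x) = 0"
      "g p x u = 0" "g p (J p x) u = 0" "g p x (J p u) = 0" "g p (J p x) (J p u) = 0"
      using D_E_orth E_D_orth u x J_D J_E by blast+
    note 3 = zD[OF u(1)] zD[OF J_D[OF u(1)]]
    have "card {u, J p u, x, J p x, z} \<le> dim (UNIV :: (real^4) set)"
    proof (rule orthogonal_card_le[OF c])
      show "{u, J p u, x, J p x, z} \<subseteq> range (coord_vec A c p)"
        using T J z(2) tangent_space_chart[OF c] by simp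
    qed (use u x z0 J 1 2 3 z in auto)
    moreover have "u \<noteq> J p u" "u \<noteq> x" "u \<noteq> J p x" "u \<noteq> z" "J p u \<noteq> x" "J p u \<noteq> J p x" "J p u \<noteq> z"
      "x \<noteq> J p x" "x \<noteq> z" "J p x \<noteq> z"
      using orthogonal_distinct[OF T(1) u(2)] orthogonal_distinct[OF J(1,2)]
        orthogonal_distinct[OF T(2) x(2)] orthogonal_distinct[OF J(3,4)] 1 2 3 by auto
    then have "card {u, J p u, x, J p x, z} = 5" by simp
    ultimately show False by simp
  qed
  then show ?thesis
    using that z(1) by simp
qed

lemma decompose:
  assumes v: "v \<in> T p"
  obtains d x where "d \<in> D p" "x \<in> E p" "v = d + x"
proof -
  obtain u where u: "u \<in> D p" "u \<noteq> 0"
    by (rule obtain_D_nonzero)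
  note uT = D_tangent[OF u(1)]
  obtain a b z where z: "v = a *\<^sub>R u + b *\<^sub>R J p u + z" "z \<in> T p" "g p z u = 0" "g p z (J p u) = 0"
    using project_complex_line[OF uT u(2) v] by blast
  have "g p z w = 0" if "w \<in> D p" for w
  proof -
    obtain a' b' where "w = a' *\<^sub>R u + b' *\<^sub>R J p u"
      using D_span[OF u \<open>w \<in> D p\<close>] by blast
    then show ?thesis
      using z uT by (simp add: metric_simps T_scale J_closed)
  qed
  then have "z \<in> E p"
    using z(2) unfolding orth_complement_def by blast
  moreover have "a *\<^sub>R u + b *\<^sub>R J p u \<in> D p"
    using u(1) J_D subspace_D by (simp add: subspace_add subspace_scale)
  ultimately show ?thesis
    using that z(1) by blast
qed

text \<open>The double complement of \<open>D\<close> is \<open>D\<close>; this lets membership in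
  \<open>D\<close> be checked by scalar equations.\<close>

lemma D_of_orth_E:
  assumes v: "v \<in> T p" and orth: "\<And>x. x \<in> E p \<Longrightarrow> g p v x = 0"
  shows "v \<in> D p"
proof -
  obtain d x where dx: "d \<in> D p" "x \<in> E p" "v = d + x"
    using decompose[OF v] by blast
  have "g p x x = 0"
    using orth[OF dx(2)] D_E_orth[OF dx(1,2)] dx D_tangent E_tangent by (simp add: metric_simps)
  then have "x = 0"
    using metric_eq_0 E_tangent[OF dx(2)] by blast
  then show ?thesis
    using dx by simp
qed

text \<open>The orthogonal projection onto \<open>E\<close> is \<open>(1 + J I) / 2\<close>, hence smooth.\<close>

lemma obtain_E_extension:
  assumes x: "x \<in> E p"
  obtains U X where "open U" "p \<in> U" "smooth_vf A U X" "X p = x" "\<And>q. q \<in> U \<Longrightarrow> X q \<in> E q"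
proof -
  obtain U X where U: "open U" "p \<in> U" and X: "smooth_vf A U X" "X p = x"
    using obtain_smooth_extension[OF E_tangent[OF x]] by blast
  define Y where "Y = (\<lambda>q. (1/2) *\<^sub>R (X q + J q (I q (X q))))"
  \<comment> \<open>On \<open>D\<close> the composite \<open>J I\<close> is \<open>J J = -1\<close>,
    on \<open>E\<close> it is \<open>- J J = 1\<close>.\<close>
  have proj: "(1/2) *\<^sub>R (v + J q (I q v)) = y" if "d \<in> D q" "y \<in> E q" "v = d + y" for q v d y
  proof -
    have "J q (I q v) = J q (J q d) - J q (J q y)"
      using that I_D[OF that(1)] I_E[OF that(2)] D_tangent[OF that(1)] E_tangent[OF that(2)]
      by (simp add: H.J_add J_diff J_closed)
    also have "\<dots> = - d + y"
      using J_J D_tangent[OF that(1)] E_tangent[OF that(2)] by simp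
    finally have "v + J q (I q v) = (1 + 1) *\<^sub>R y"
      unfolding that(3) scaleR_left.add by simp
    then show ?thesis by simp
  qed
  have "smooth_vf A U Y"
    unfolding Y_def by (intro smooth_vf_scale smooth_vf_add X J_smooth[OF U(1)] H.J_smooth[OF U(1)])
  moreover have "Y p = x"
    using proj[OF subspace_0[OF subspace_D] x] X(2) by (simp add: Y_def)
  moreover have "Y q \<in> E q" if q: "q \<in> U" for q
  proof -
    obtain d y where "d \<in> D q" "y \<in> E q" "X q = d + y"
      using decompose[OF smooth_vf_tangent[OF X(1) q]] by blast
    then show ?thesis
      using proj by (simp add: Y_def)
  qed
  ultimately show ?thesis
    using that U by blast
qed

section \<open>The two Kaehler forms and the form \<open>\<theta>\<close>\<close>

abbreviation \<omega> :: "'a \<Rightarrow> 'a tvec \<Rightarrow> 'a tvec \<Rightarrow> real" where "\<omega> \<equiv> kaehler_form g J"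

abbreviation \<Omega> :: "'a \<Rightarrow> 'a tvec \<Rightarrow> 'a tvec \<Rightarrow> real" where "\<Omega> \<equiv> kaehler_form g I"

lemma Omega_D_left: "d \<in> D p \<Longrightarrow> \<Omega> p d v = \<omega> p d v"
  by (simp add: kaehler_form_def I_D)

lemma Omega_D_right: "d \<in> D p \<Longrightarrow> v \<in> T p \<Longrightarrow> \<Omega> p v d = \<omega> p v d"
  by (simp add: kaehler_form_def I_D D_tangent metric_J_left H.metric_J_left)

lemma Omega_E_right: "x \<in> E p \<Longrightarrow> v \<in> T p \<Longrightarrow> \<Omega> p v x = - \<omega> p v x"
  by (simp add: kaehler_form_def I_E E_tangent metric_J_left H.metric_J_left metric_minus_right J_closed)

lemma omega_D_E: "d \<in> D p \<Longrightarrow> x \<in> E p \<Longrightarrow> \<omega> p d x = 0"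
  by (simp add: kaehler_form_def D_E_orth J_D)

text \<open>Evaluated on two fields tangent to \<open>D\<close> and one further field,
  \<open>d\<Omega>\<^sub>I\<close> and \<open>d\<omega>\<close> agree term by term: every pairing
  has an argument in \<open>D\<close>, except the one with the bracket of the two fields in
  \<open>D\<close>, and that bracket is 0 here. So \<open>d\<Omega>\<^sub>I\<close> vanishes on
  \<open>u\<close>, \<open>J u\<close>, \<open>x\<close>, while the wedge product reduces to
  \<open>\<theta>(x) g(u, u)\<close>.\<close>

lemma theta_E:
  assumes x: "x \<in> E p"
  shows "\<theta> p x = 0"
proof -
  obtain c W where c: "admissible A c" "p \<in> fst c" and W: "\<And>q. q \<in> fst c \<Longrightarrow> D q = coord_vec A c q ` W"
    using obtain_foliation_chart[of p] by metis
  obtain u where u: "u \<in> D p" "u \<noteq> 0"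
    by (rule obtain_D_nonzero)
  obtain w1 w2 where w: "w1 \<in> W" "w2 \<in> W" "u = coord_vec A c p w1" "J p u = coord_vec A c p w2"
    using u(1) J_D[OF u(1)] W[OF c(2)] by blast
  obtain U X where U: "open U" "p \<in> U" and X: "smooth_vf A U X" "X p = x" "\<And>q. q \<in> U \<Longrightarrow> X q \<in> E q"
    using obtain_E_extension[OF x] by blast
  define V where "V = U \<inter> fst c"
  \<comment> \<open>Constant coefficients from \<open>W\<close> in a foliation chart give fields
    that are tangent to the leaves and commute.\<close>
  define Y where "Y = (\<lambda>q. coord_vec A c q w1)"
  define Z where "Z = (\<lambda>q. coord_vec A c q w2)"
  have V: "open V" "p \<in> V" "V \<subseteq> U" "V \<subseteq> fst c"
    using U c open_Int[OF U(1) open_chart_domain[OF c(1)]] by (auto simp: V_def)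
  have smooth: "smooth_vf A V X" "smooth_vf A V Y" "smooth_vf A V Z"
    unfolding Y_def Z_def
    by (rule smooth_vf_subset[OF X(1) V(3)] smooth_vf_subset[OF smooth_vf_coord_vec[OF c(1)] V(4)])+
  have YZ: "Y q \<in> D q" "Z q \<in> D q" if "q \<in> V" for q
    using W w V(4) that by (auto simp: Y_def Z_def)
  have p: "Y p = u" "Z p = J p u"
    unfolding Y_def Z_def using w by simp_all
  note T = D_tangent[OF u(1)] J_closed[OF D_tangent[OF u(1)]] E_tangent[OF x]
  note cong = tangent_vector_cong[OF _ V(1,2)]
  have "ext_deriv2 A \<Omega> Y Z X p = ext_deriv2 A \<omega> Y Z X p"
  proof -
    have "Y p (\<lambda>q. \<Omega> q (Z q) (X q)) = Y p (\<lambda>q. \<omega> q (Z q) (X q))"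
      by (rule cong) (use p T YZ in \<open>auto simp: Omega_D_left\<close>)
    moreover have "Z p (\<lambda>q. \<Omega> q (Y q) (X q)) = Z p (\<lambda>q. \<omega> q (Y q) (X q))"
      by (rule cong) (use p T YZ in \<open>auto simp: Omega_D_left\<close>)
    moreover have "X p (\<lambda>q. \<Omega> q (Y q) (Z q)) = X p (\<lambda>q. \<omega> q (Y q) (Z q))"
      by (rule cong) (use X(2) T YZ in \<open>auto simp: Omega_D_left\<close>)
    moreover have "\<Omega> p (lie_bracket A Y X p) (Z p) = \<omega> p (lie_bracket A Y X p) (Z p)"
      "\<Omega> p (lie_bracket A Z X p) (Y p) = \<omega> p (lie_bracket A Z X p) (Y p)"
      using Omega_D_right YZ[OF V(2)] lie_bracket_closed[OF V(1,2)] smooth by blast+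
    moreover have "lie_bracket A Y Z p = 0"
      unfolding Y_def Z_def by (rule lie_bracket_coord_vec[OF c])
    ultimately show ?thesis
      by (simp add: ext_deriv2_def) (simp add: kaehler_form_def J_0 H.J_0)
  qed
  also have "\<dots> = 0"
    using closed V smooth unfolding closed_2form_def by blast
  finally have "wedge12 \<theta> \<Omega> p u (J p u) x = 0"
    using ext_deriv_I[OF V(1,2) smooth(2,3,1)] by (simp add: p X(2))
  moreover have "\<Omega> p (J p u) x = 0" "\<Omega> p u x = 0"
    using Omega_D_left omega_D_E u x J_D by metis+
  moreover have "\<Omega> p u (J p u) = g p u u"
    using Omega_D_left[OF u(1)] metric_J_J T by (simp add: kaehler_form_def)
  ultimately show ?thesis
    using metric_pos[OF T(1) u(2)] by (simp add: wedge12_def)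
qed

section \<open>Covariant derivatives of sections of \<open>D\<close>\<close>

lemma section_smooth: "\<xi> \<in> sections A D \<Longrightarrow> smooth_vf A U \<xi>"
  using smooth_vf_subset[of A UNIV \<xi> U] unfolding sections_def by simp

lemma section_D: "\<xi> \<in> sections A D \<Longrightarrow> \<xi> p \<in> D p"
  unfolding sections_def by simp

lemma J_section: "\<xi> \<in> sections A D \<Longrightarrow> (\<lambda>q. J q (\<xi> q)) \<in> sections A D"
  using J_smooth[OF open_UNIV] J_D unfolding sections_def by simp

lemma nabla_section_closed: "\<xi> \<in> sections A D \<Longrightarrow> v \<in> T p \<Longrightarrow> nabla \<xi> p v \<in> T p"
  using nabla_closed[OF open_UNIV UNIV_I section_smooth] by blast

lemma nabla_section_lin: "\<xi> \<in> sections A D \<Longrightarrow> lin_on (T p) (nabla \<xi> p)"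
  using nabla_lin(1)[OF open_UNIV UNIV_I section_smooth] by blast

lemma nabla_section_scale:
  "\<xi> \<in> sections A D \<Longrightarrow> v \<in> T p \<Longrightarrow> nabla \<xi> p (r *\<^sub>R v) = r *\<^sub>R nabla \<xi> p v"
  using nabla_section_lin unfolding lin_on_def by blast

lemma nabla_section_0: "\<xi> \<in> sections A D \<Longrightarrow> nabla \<xi> p 0 = 0"
  using nabla_section_scale[of \<xi> 0 p 0] T_0 by simp

text \<open>On \<open>E\<close> the equation for \<open>d\<Omega>\<^sub>I\<close> says that \<open>L\<^sub>\<xi> \<omega> = \<theta>(\<xi>) \<omega>\<close>: adding \<open>d\<omega> = 0\<close> to it removes
  the bracket of the two arguments in \<open>E\<close>.\<close>

lemma trace_nabla_section:
  assumes \<xi>: "\<xi> \<in> sections A D" and x: "x \<in> E p"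
  shows "g p (nabla \<xi> p x) x + g p (nabla \<xi> p (J p x)) (J p x) = \<theta> p (\<xi> p) * g p x x"
proof -
  obtain U X where U: "open U" "p \<in> U" and X: "smooth_vf A U X" "X p = x" "\<And>q. q \<in> U \<Longrightarrow> X q \<in> E q"
    using obtain_E_extension[OF x] by blast
  define Y where "Y = (\<lambda>q. J q (X q))"
  have Y: "smooth_vf A U Y" "Y p = J p x"
    unfolding Y_def using J_smooth[OF U(1) X(1)] X(2) by simp_all
  note S = section_smooth[OF \<xi>, of U]
  note T = smooth_vf_tangent[OF X(1)] smooth_vf_tangent[OF Y(1)] smooth_vf_tangent[OF S]
  note brackets = lie_bracket_closed[OF U S X(1)] lie_bracket_closed[OF U S Y(1)] lie_bracket_closed[OF U X(1) Y(1)]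
  note cong = tangent_vector_cong[OF _ U]
  have XE: "X q \<in> E q" "Y q \<in> E q" if "q \<in> U" for q
    using X(3)[OF that] J_E by (simp_all add: Y_def)
  define F where "F = (\<lambda>q. g q (X q) (X q))"
  have F: "\<omega> q (X q) (Y q) = F q" "\<Omega> q (X q) (Y q) = (-1) * F q" if "q \<in> U" for q
  proof -
    show "\<omega> q (X q) (Y q) = F q"
      using metric_J_J T(1)[OF that] by (simp add: kaehler_form_def Y_def F_def)
    then show "\<Omega> q (X q) (Y q) = (-1) * F q"
      using Omega_E_right XE[OF that] T(1)[OF that] by simp
  qed
  have near: "smooth_near A p F"
    using smooth_nearI[OF U metric_smooth[OF U(1) X(1) X(1)]] by (simp add: F_def)
  \<comment> \<open>This needs a field lying in \<open>E\<close> on the whole neighbourhood: the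
    pairings with \<open>\<xi>\<close> must vanish near \<open>p\<close> for their derivatives to
    vanish at \<open>p\<close>.\<close>
  have zero: "v (\<lambda>q. \<omega> q (\<xi> q) (Z q)) = 0" "v (\<lambda>q. \<Omega> q (\<xi> q) (Z q)) = 0"
    if "\<And>q. q \<in> U \<Longrightarrow> Z q \<in> E q" "v \<in> T p" for v Z
  proof -
    have "\<omega> q (\<xi> q) (Z q) = 0" "\<Omega> q (\<xi> q) (Z q) = 0" if "q \<in> U" for q
      using \<open>q \<in> U \<Longrightarrow> Z q \<in> E q\<close> that omega_D_E Omega_D_left section_D[OF \<xi>] by auto
    then show "v (\<lambda>q. \<omega> q (\<xi> q) (Z q)) = 0" "v (\<lambda>q. \<Omega> q (\<xi> q) (Z q)) = 0"
      using cong[OF that(2), of _ "\<lambda>q. 0"] tangent_vector_0[OF that(2)] by auto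
  qed
  have \<xi>F: "\<xi> p (\<lambda>q. \<omega> q (X q) (Y q)) = \<xi> p F" "\<xi> p (\<lambda>q. \<Omega> q (X q) (Y q)) = - \<xi> p F"
  proof -
    show "\<xi> p (\<lambda>q. \<omega> q (X q) (Y q)) = \<xi> p F"
      by (rule cong[OF T(3)[OF U(2)]]) (rule F)
    have "\<xi> p (\<lambda>q. \<Omega> q (X q) (Y q)) = \<xi> p (\<lambda>q. (-1) * F q)"
      by (rule cong[OF T(3)[OF U(2)]]) (rule F)
    then show "\<xi> p (\<lambda>q. \<Omega> q (X q) (Y q)) = - \<xi> p F"
      using tangent_vector_scale[OF T(3)[OF U(2)] near, of "-1"] by simp
  qed
  have "ext_deriv2 A \<omega> \<xi> X Y p = 0"
    using closed U S X(1) Y(1) unfolding closed_2form_def by blast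
  then have 1: "\<xi> p F - \<omega> p (lie_bracket A \<xi> X p) (Y p) + \<omega> p (lie_bracket A \<xi> Y p) (X p)
      - \<omega> p (lie_bracket A X Y p) (\<xi> p) = 0"
    by (simp add: ext_deriv2_def \<xi>F zero[OF XE(1) T(2)[OF U(2)]] zero[OF XE(2) T(1)[OF U(2)]])
  have wedge: "wedge12 \<theta> \<Omega> p (\<xi> p) (X p) (Y p) = - (\<theta> p (\<xi> p) * F p)"
    using F(2)[OF U(2)] omega_D_E[OF section_D[OF \<xi>]] XE[OF U(2)]
    by (simp add: wedge12_def Omega_D_left[OF section_D[OF \<xi>]])
  have "ext_deriv2 A \<Omega> \<xi> X Y p = - \<xi> p F + \<omega> p (lie_bracket A \<xi> X p) (Y p) - \<omega> p (lie_bracket A \<xi> Y p) (X p)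
      - \<omega> p (lie_bracket A X Y p) (\<xi> p)"
    using Omega_E_right[OF XE(2)[OF U(2)] brackets(1)] Omega_E_right[OF XE(1)[OF U(2)] brackets(2)]
      Omega_D_right[OF section_D[OF \<xi>] brackets(3)]
    by (simp add: ext_deriv2_def \<xi>F zero[OF XE(1) T(2)[OF U(2)]] zero[OF XE(2) T(1)[OF U(2)]])
  \<comment> \<open>Subtracting this equation from the one for \<open>\<omega>\<close> cancels the
    term with \<open>[X, Y]\<close> and doubles all others; the factor 2 in the equation for
    \<open>d\<Omega>\<^sub>I\<close> then drops out.\<close>
  then have 2: "\<xi> p F - \<omega> p (lie_bracket A \<xi> X p) (Y p) + \<omega> p (lie_bracket A \<xi> Y p) (X p) = \<theta> p (\<xi> p) * F p"
    using 1 ext_deriv_I[OF U S X(1) Y(1)] wedge by simp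
  \<comment> \<open>The derivative of \<open>X\<close> along \<open>\<xi>\<close> depends on the
    chosen extension. It enters the derivative of \<open>F\<close> twice and each of the two bracket
    terms once, and cancels.\<close>
  define n where "n = nabla X p (\<xi> p)"
  have xT: "x \<in> T p" "J p x \<in> T p"
    using E_tangent[OF x] J_closed by auto
  have nT: "n \<in> T p" "nabla \<xi> p x \<in> T p" "nabla \<xi> p (J p x) \<in> T p"
    unfolding n_def using nabla_closed[OF U X(1) T(3)[OF U(2)]] nabla_section_closed[OF \<xi>] xT by auto
  have "\<xi> p F = 2 * g p n x"
    using metric_compatible[OF U X(1) X(1) T(3)[OF U(2)]] metric_sym[OF xT(1) nT(1)]
    by (simp add: F_def X(2) n_def)
  moreover have "\<omega> p (lie_bracket A \<xi> X p) (Y p) = g p n x - g p (nabla \<xi> p x) x"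
    unfolding torsion_free[OF U S X(1)] Y(2) X(2) n_def[symmetric] kaehler_form_def
    using metric_J_J[OF T_diff[OF nT(1,2)] xT(1)] nT xT by (simp add: metric_simps)
  moreover have "\<omega> p (lie_bracket A \<xi> Y p) (X p) = - g p n x + g p (nabla \<xi> p (J p x)) (J p x)"
  proof -
    have "lie_bracket A \<xi> Y p = J p n - nabla \<xi> p (J p x)"
      unfolding torsion_free[OF U S Y(1)] Y(2)
      using nabla_J[OF U X(1) T(3)[OF U(2)]] by (simp add: Y_def n_def)
    then show ?thesis
      using metric_J_left[OF T_diff[OF J_closed[OF nT(1)] nT(3)] xT(1)] nT xT metric_J_J[OF nT(1) xT(1)]
      by (simp add: kaehler_form_def X(2) metric_simps J_closed)
  qed
  ultimately show ?thesis
    using 2 by (simp add: F_def X(2))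
qed

section \<open>The three conditions as equations for the derivative of a section\<close>

lemma nabla_J_section:
  "\<xi> \<in> sections A D \<Longrightarrow> v \<in> T p \<Longrightarrow> nabla (\<lambda>q. J q (\<xi> q)) p v = J p (nabla \<xi> p v)"
  using nabla_J[OF open_UNIV UNIV_I section_smooth] by blast

text \<open>Pairing with all of \<open>E\<close> replaces membership in \<open>D\<close> by a scalar
  equation, and the value of the Lie derivative at \<open>p\<close> involves only
  \<open>X p\<close>; so a condition on fields becomes one on vectors.\<close>

lemma quasi_holomorphic_iff:
  "quasi_holomorphic A g J D \<longleftrightarrow> (\<forall>\<xi>\<in>sections A D. \<forall>p. \<forall>x\<in>E p. \<forall>y\<in>E p.
     g p (nabla \<xi> p (J p x)) y + g p (nabla \<xi> p x) (J p y) = 0)"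
proof -
  have pair: "g p (J p (nabla \<xi> p x) - nabla \<xi> p (J p x)) y =
      - (g p (nabla \<xi> p (J p x)) y + g p (nabla \<xi> p x) (J p y))"
    if "\<xi> \<in> sections A D" "x \<in> E p" "y \<in> E p" for \<xi> p x y
  proof -
    have "x \<in> T p" "J p x \<in> T p" "y \<in> T p"
      using that E_tangent J_closed by blast+
    moreover then have "nabla \<xi> p x \<in> T p" "nabla \<xi> p (J p x) \<in> T p"
      using nabla_section_closed[OF that(1)] by blast+
    ultimately show ?thesis
      by (simp add: metric_simps J_closed metric_J_left)
  qed
  show ?thesis
  proof (intro iffI ballI allI)
    fix \<xi> p x y
    assume q: "quasi_holomorphic A g J D" and *: "\<xi> \<in> sections A D" "x \<in> E p" "y \<in> E p"
    obtain U X where U: "open U" "p \<in> U" and X: "smooth_vf A U X" "X p = x"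
      using obtain_smooth_extension[OF E_tangent[OF *(2)]] by blast
    have "lie_deriv_endo A J \<xi> X p \<in> D p"
      using q U X * unfolding quasi_holomorphic_def by blast
    then have "J p (nabla \<xi> p x) - nabla \<xi> p (J p x) \<in> D p"
      using lie_deriv_J_eq[OF U section_smooth[OF *(1)] X(1)] X(2) by simp
    then show "g p (nabla \<xi> p (J p x)) y + g p (nabla \<xi> p x) (J p y) = 0"
      using pair[OF *] D_E_orth[OF _ *(3)] by simp
  next
    assume *: "\<forall>\<xi>\<in>sections A D. \<forall>p. \<forall>x\<in>E p. \<forall>y\<in>E p.
      g p (nabla \<xi> p (J p x)) y + g p (nabla \<xi> p x) (J p y) = 0"
    show "quasi_holomorphic A g J D"
      unfolding quasi_holomorphic_def
    proof (intro ballI allI impI, elim conjE)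
      fix \<xi> U X p
      assume \<xi>: "\<xi> \<in> sections A D" and U: "open U" "p \<in> U" and X: "smooth_vf A U X" "X p \<in> E p"
      have "J p (nabla \<xi> p (X p)) - nabla \<xi> p (J p (X p)) \<in> D p"
      proof (rule D_of_orth_E)
        show "J p (nabla \<xi> p (X p)) - nabla \<xi> p (J p (X p)) \<in> T p"
          using nabla_section_closed[OF \<xi>] E_tangent[OF X(2)] J_closed T_diff by blast
      qed (use pair[OF \<xi> X(2)] * \<xi> X(2) in simp)
      then show "lie_deriv_endo A J \<xi> X p \<in> D p"
        using lie_deriv_J_eq[OF U section_smooth[OF \<xi>] X(1)] by simp
    qed
  qed
qed

text \<open>In the orthogonal basis \<open>x\<close>, \<open>J x\<close> of \<open>E\<close>,
  conformality makes the diagonal entries of \<open>B\<close> equal and its off-diagonal entries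
  opposite. The function \<open>\<alpha>\<close> drops out of both relations, and they are exactly
  what the required identity needs for every \<open>y\<close>.\<close>

lemma conformal_imp_quasi_holomorphic:
  assumes "conformal_foliation A g D"
  shows "quasi_holomorphic A g J D"
  unfolding quasi_holomorphic_iff
proof (intro ballI allI)
  fix \<xi> p x y
  assume \<xi>: "\<xi> \<in> sections A D" and x: "x \<in> E p" and y: "y \<in> E p"
  obtain \<alpha> where "\<forall>V\<in>sections A D. \<forall>U X Y p. open U \<and> p \<in> U \<and> smooth_vf A U X \<and> smooth_vf A U Y \<and>
      X p \<in> E p \<and> Y p \<in> E p \<longrightarrow> lie_deriv_metric A g V X Y p = \<alpha> p (V p) * g p (X p) (Y p)"
    using assms unfolding conformal_foliation_def by (elim exE conjE)
  then have \<alpha>: "lie_deriv_metric A g \<xi> X Y p = \<alpha> p (\<xi> p) * g p (X p) (Y p)"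
    if "open U" "p \<in> U" "smooth_vf A U X" "smooth_vf A U Y" "X p \<in> E p" "Y p \<in> E p" for U X Y p
    using \<xi> that by simp
  have sym: "g p (nabla \<xi> p v) w + g p v (nabla \<xi> p w) = \<alpha> p (\<xi> p) * g p v w"
    if v: "v \<in> E p" and w: "w \<in> E p" for v w
  proof -
    obtain U X where U: "open U" "p \<in> U" and X: "smooth_vf A U X" "X p = v"
      using obtain_smooth_extension[OF E_tangent[OF v]] by blast
    obtain V Y where V: "open V" "p \<in> V" and Y: "smooth_vf A V Y" "Y p = w"
      using obtain_smooth_extension[OF E_tangent[OF w]] by blast
    have UV: "open (U \<inter> V)" "p \<in> U \<inter> V" "smooth_vf A (U \<inter> V) X" "smooth_vf A (U \<inter> V) Y"
      using U V smooth_vf_subset[OF X(1)] smooth_vf_subset[OF Y(1)] by auto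
    show ?thesis
      using \<alpha>[OF UV] lie_deriv_metric_eq[OF UV(1,2) section_smooth[OF \<xi>] UV(3,4)] v w X(2) Y(2) by simp
  qed
  note xT = E_tangent[OF x] J_closed[OF E_tangent[OF x]]
  note nT = nabla_section_closed[OF \<xi> xT(1)] nabla_section_closed[OF \<xi> xT(2)]
  show "g p (nabla \<xi> p (J p x)) y + g p (nabla \<xi> p x) (J p y) = 0"
  proof (cases "x = 0")
    case True
    then show ?thesis
      using nabla_section_0[OF \<xi>] metric_0_left E_tangent[OF y] J_closed by (simp add: J_0)
  next
    case False
    obtain a b where y: "y = a *\<^sub>R x + b *\<^sub>R J p x"
      using E_span[OF x False y] by blast
    have Jy: "J p y = a *\<^sub>R J p x - b *\<^sub>R x"
      unfolding y using xT by (simp add: J_add J_scale J_J T_scale)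
    have "g p (nabla \<xi> p (J p x)) x = - g p (nabla \<xi> p x) (J p x)"
      using sym[OF x J_E[OF x]] metric_J_self[OF xT(1)] metric_sym[OF xT(1) nT(2)] by simp
    moreover have "g p (nabla \<xi> p (J p x)) (J p x) = g p (nabla \<xi> p x) x"
      using sym[OF x x] sym[OF J_E[OF x] J_E[OF x]] metric_J_J[OF xT(1,1)]
        metric_sym[OF xT(1) nT(1)] metric_sym[OF xT(2) nT(2)] by simp
    ultimately show ?thesis
      unfolding Jy unfolding y using xT nT by (simp add: metric_simps T_scale)
  qed
qed

text \<open>For \<open>y = a x + b J x\<close> the coefficients are \<open>g(x, y)\<close> and
  \<open>\<omega>(x, y)\<close> divided by \<open>g(x, x)\<close>, which explains the two terms on
  the right. It remains to find \<open>B(x, x)\<close> and \<open>B(x, J x)\<close>.\<close>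

lemma quasi_holomorphic_imp_nabla:
  assumes q: "quasi_holomorphic A g J D" and \<xi>: "\<xi> \<in> sections A D" and x: "x \<in> E p" and y: "y \<in> E p"
  shows "2 * g p (nabla \<xi> p x) y = \<theta> p (\<xi> p) * g p x y + J_one_form J \<theta> p (\<xi> p) * \<omega> p x y"
proof (cases "x = 0")
  case True
  then show ?thesis
    using nabla_section_0[OF \<xi>] metric_0_left[OF E_tangent[OF y]] by (simp add: kaehler_form_def J_0)
next
  case False
  obtain a b where y: "y = a *\<^sub>R x + b *\<^sub>R J p x"
    using E_span[OF x False y] by blast
  note xT = E_tangent[OF x] J_closed[OF E_tangent[OF x]]
  note nT = nabla_section_closed[OF \<xi> xT(1)] nabla_section_closed[OF \<xi> xT(2)]
  have skew: "g p (nabla \<xi> p (J p x)) z + g p (nabla \<xi> p x) (J p z) = 0" if "z \<in> E p" for z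
    using q \<xi> x that unfolding quasi_holomorphic_iff by blast
  \<comment> \<open>Quasi holomorphy makes the two summands of the trace equal, which produces the
    factor 2.\<close>
  have "g p (nabla \<xi> p (J p x)) (J p x) = g p (nabla \<xi> p x) x"
    using skew[OF J_E[OF x]] J_J[OF xT(1)] nT xT by (simp add: metric_simps)
  then have 1: "2 * g p (nabla \<xi> p x) x = \<theta> p (\<xi> p) * g p x x"
    using trace_nabla_section[OF \<xi> x] by simp
  \<comment> \<open>The trace formula for \<open>J \<xi>\<close>, with \<open>J\<close> taken out of
    the covariant derivative and moved across \<open>g\<close>. Its right side contains
    \<open>\<theta>(J \<xi>)\<close>, which is minus \<open>J \<theta>\<close> evaluated at
    \<open>\<xi>\<close>.\<close>
  have "- g p (nabla \<xi> p x) (J p x) + g p (nabla \<xi> p (J p x)) x = \<theta> p (J p (\<xi> p)) * g p x x"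
    using trace_nabla_section[OF J_section[OF \<xi>] x] nabla_J_section[OF \<xi> xT(1)] nabla_J_section[OF \<xi> xT(2)]
      metric_J_left[OF nT(1) xT(1)] metric_J_J[OF nT(2) xT(1)] by simp
  then have 2: "2 * g p (nabla \<xi> p x) (J p x) = J_one_form J \<theta> p (\<xi> p) * g p x x"
    using skew[OF x] by (simp add: J_one_form_def)
  have "g p x y = a * g p x x" "\<omega> p x y = b * g p x x"
    unfolding y kaehler_form_def using xT metric_J_self[OF xT(1)] metric_J_J[OF xT(1,1)]
      metric_sym[OF xT(2,1)] by (simp_all add: metric_simps T_scale)
  moreover have "2 * g p (nabla \<xi> p x) y = a * (2 * g p (nabla \<xi> p x) x) + b * (2 * g p (nabla \<xi> p x) (J p x))"
    unfolding y using xT nT by (simp add: metric_simps T_scale)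
  ultimately show ?thesis
    unfolding 1 2 by simp
qed

text \<open>Symmetrising in the two vectors removes the term with the skew form
  \<open>\<omega>\<close>, so \<open>\<theta>\<close> can be taken as \<open>\<alpha>\<close>; that
  it vanishes on \<open>E\<close> is \<open>theta_E\<close>.\<close>

lemma nabla_imp_conformal:
  assumes \<theta>: "one_form A \<theta>"
    and nabla: "\<And>\<xi> p x y. \<lbrakk>\<xi> \<in> sections A D; x \<in> E p; y \<in> E p\<rbrakk> \<Longrightarrow>
      2 * g p (nabla \<xi> p x) y = \<theta> p (\<xi> p) * g p x y + J_one_form J \<theta> p (\<xi> p) * \<omega> p x y"
  shows "conformal_foliation A g D"
  unfolding conformal_foliation_def
proof (intro exI[of _ \<theta>] conjI \<theta> allI ballI theta_E impI, assumption, elim conjE)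
  fix \<xi> U X Y p
  assume \<xi>: "\<xi> \<in> sections A D" and U: "open U" "p \<in> U" and X: "smooth_vf A U X" and Y: "smooth_vf A U Y"
    and E: "X p \<in> E p" "Y p \<in> E p"
  note T = E_tangent[OF E(1)] E_tangent[OF E(2)]
  have "\<omega> p (Y p) (X p) = - \<omega> p (X p) (Y p)"
    using metric_J_left[OF T(2,1)] metric_sym[OF T(2) J_closed[OF T(1)]] by (simp add: kaehler_form_def)
  then have "g p (nabla \<xi> p (X p)) (Y p) + g p (nabla \<xi> p (Y p)) (X p) = \<theta> p (\<xi> p) * g p (X p) (Y p)"
    using nabla[OF \<xi> E] nabla[OF \<xi> E(2,1)] metric_sym[OF T] by simp
  then show "lie_deriv_metric A g \<xi> X Y p = \<theta> p (\<xi> p) * g p (X p) (Y p)"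
    using lie_deriv_metric_eq[OF U section_smooth[OF \<xi>] X Y]
      metric_sym[OF T(1) nabla_section_closed[OF \<xi> T(2)]] by simp
qed

end

theorem theorem6:
  fixes A :: "'m::{t2_space,second_countable_topology} chart set"
    and g :: "'m \<Rightarrow> 'm tvec \<Rightarrow> 'm tvec \<Rightarrow> real"
    and J I :: "'m \<Rightarrow> 'm tvec \<Rightarrow> 'm tvec"
    and nabla :: "'m connection"
    and \<omega> \<Omega>I :: "'m \<Rightarrow> 'm tvec \<Rightarrow> 'm tvec \<Rightarrow> real"
    and D E :: "'m \<Rightarrow> 'm tvec set"
    and \<theta> :: "'m \<Rightarrow> 'm tvec \<Rightarrow> real"
  assumes "kaehler_surface A g J"
    and "levi_civita A g nabla"
    and "\<omega> = kaehler_form g J"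
    and "foliation A 2 D"
    and "complex_distribution J D"
    and "E = orth_complement A g D"
    and "almost_hermitian A g I"
    and "\<And>p v. v \<in> D p \<Longrightarrow> I p v = J p v"
    and "\<And>p v. v \<in> E p \<Longrightarrow> I p v = - J p v"
    and "\<Omega>I = kaehler_form g I"
    and "one_form A \<theta>"
    and "\<And>U X Y Z p. \<lbrakk>open U; p \<in> U; smooth_vf A U X; smooth_vf A U Y; smooth_vf A U Z\<rbrakk> \<Longrightarrow>
           ext_deriv2 A \<Omega>I X Y Z p = 2 * wedge12 \<theta> \<Omega>I p (X p) (Y p) (Z p)"
  shows "(conformal_foliation A g D \<longleftrightarrow> quasi_holomorphic A g J D) \<and>
    (quasi_holomorphic A g J D \<longleftrightarrow>
       (\<forall>\<xi>\<in>sections A D. \<forall>p. \<forall>X\<in>E p. \<forall>Y\<in>E p.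
          2 * g p (nabla \<xi> p X) Y = \<theta> p (\<xi> p) * g p X Y + J_one_form J \<theta> p (\<xi> p) * \<omega> p X Y))"
proof -
  have K: "is_atlas A" "almost_hermitian A g J" "integrable_complex A J" "closed_2form A (kaehler_form g J)"
    using assms(1) unfolding kaehler_surface_def by simp_all
  interpret complex_foliation A g J nabla D I \<theta>
    by unfold_locales
       (fact K assms(2,4,5,7,8) assms(9)[unfolded assms(6)] assms(12)[unfolded assms(10)])+
  have "conformal_foliation A g D"
    if "\<forall>\<xi>\<in>sections A D. \<forall>p. \<forall>X\<in>E p. \<forall>Y\<in>E p.
      2 * g p (nabla \<xi> p X) Y = \<theta> p (\<xi> p) * g p X Y + J_one_form J \<theta> p (\<xi> p) * \<omega> p X Y"
    using that nabla_imp_conformal[OF assms(11)] unfolding assms(3,6) by blast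
  moreover have "\<forall>\<xi>\<in>sections A D. \<forall>p. \<forall>X\<in>E p. \<forall>Y\<in>E p.
      2 * g p (nabla \<xi> p X) Y = \<theta> p (\<xi> p) * g p X Y + J_one_form J \<theta> p (\<xi> p) * \<omega> p X Y"
    if "quasi_holomorphic A g J D"
    unfolding assms(3,6) using quasi_holomorphic_imp_nabla[OF that] by (intro ballI allI)
  \<comment> \<open>The implications from (a) to (b), (b) to (c) and (c) to (a) close the
    cycle.\<close>
  ultimately show ?thesis
    using conformal_imp_quasi_holomorphic by argo
qed

end
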